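(* Let $p,q$ be positive integers, let $\pi=(\alpha\mid\beta)$ (Frobenius notation) be a partition whose Young diagram fits inside a rectangle with $p$ rows and $q$ columns, and let $m$ be a nonnegative integer. Then $$\dim F^{(p)}_{(\alpha+m\,\mid\,\beta)}\;\dim F^{(q)}_{(\beta+m\,\mid\,\alpha)}\;=\;\dim F^{(p+m)}_{(\alpha\,\mid\,\beta+m)}\;\dim F^{(q+m)}_{(\beta\,\mid\,\alpha+m)} .$$
   Context: Frobenius notation: let $r$ be the length of the main diagonal of the Young diagram of a partition $\pi$. Write $\pi=(\alpha\mid\beta)=(\alpha_1,\dots,\alpha_r\mid\beta_1,\dots,\beta_r)$, where $\alpha_i$ is the number of boxes in row $i$ strictly to the right of the main diagonal, and $\beta_i$ is the number of boxes in column $i$ strictly below the main diagonal; so $\alpha_1>\cdots>\alpha_r\ge 0$ and $\beta_1>\cdots>\beta_r\ge0$, and any two such strictly decreasing sequences of equal length determine a unique partition. The zero partition corresponds to $r=0$. For a nonnegative integer $m$, $\alpha+m:=(\alpha_1+m,\dots,\alpha_r+m)$. $F^{(n)}_{\mu}$ denotes the finite-dimensional simple $\mathfrak{gl}_n(\mathbb C)$-module with highest weight $\mu$, where $\mu$ is a weakly decreasing $n$-tuple of integers; a partition with at most $n$ parts is regarded as an $n$-tuple by appending zeros. *)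

theory Defs
  imports Complex_Main "Jordan_Normal_Form.Matrix"
begin

section \<open>Partitions and Frobenius notation\<close>

definition is_partition :: "nat list \<Rightarrow> bool" where
  "is_partition \<pi> \<longleftrightarrow> sorted_wrt (\<ge>) \<pi> \<and> 0 \<notin> set \<pi>"

text \<open>Boxes are pairs (row, column), both counted from \<open>0\<close>.\<close>

definition young_diagram :: "nat list \<Rightarrow> (nat \<times> nat) set" where
  "young_diagram \<pi> = {(i, j). i < length \<pi> \<and> j < \<pi> ! i}"

definition diagonal_length :: "nat list \<Rightarrow> nat" where
  "diagonal_length \<pi> = card {i. (i, i) \<in> young_diagram \<pi>}"

definition frobenius_arms :: "nat list \<Rightarrow> nat list" where
  "frobenius_arms \<pi> =
     map (\<lambda>i. card {j. i < j \<and> (i, j) \<in> young_diagram \<pi>}) [0..<diagonal_length \<pi>]"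

definition frobenius_legs :: "nat list \<Rightarrow> nat list" where
  "frobenius_legs \<pi> =
     map (\<lambda>i. card {j. i < j \<and> (j, i) \<in> young_diagram \<pi>}) [0..<diagonal_length \<pi>]"

text \<open>
  The partition written \<open>(\<alpha> | \<beta>)\<close>. It is meaningful only for strictly decreasing lists of equal
  length; the lemmas \<open>frobenius_partition_exists\<close> and \<open>frobenius_coordinates_inj\<close> below show
  that the description is then proper.
\<close>

definition frobenius_partition :: "nat list \<Rightarrow> nat list \<Rightarrow> nat list" where
  "frobenius_partition \<alpha> \<beta> =
     (THE \<pi>. is_partition \<pi> \<and> frobenius_arms \<pi> = \<alpha> \<and> frobenius_legs \<pi> = \<beta>)"

definition weight_of_partition :: "nat \<Rightarrow> nat list \<Rightarrow> int list" where
  "weight_of_partition n \<pi> = map int \<pi> @ replicate (n - length \<pi>) 0"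

lemma young_diagram_down:
  assumes "is_partition \<pi>" "(i, j) \<in> young_diagram \<pi>" "i' \<le> i" "j' \<le> j"
  shows "(i', j') \<in> young_diagram \<pi>"
proof -
  have "\<pi> ! i \<le> \<pi> ! i'"
    using assms unfolding is_partition_def young_diagram_def
    by (cases "i' = i") (auto simp: sorted_wrt_iff_nth_less)
  then show ?thesis using assms by (auto simp: young_diagram_def)
qed

lemma finite_young_diagram: "finite (young_diagram \<pi>)"
proof -
  have "young_diagram \<pi> = (SIGMA i:{..<length \<pi>}. {..<\<pi> ! i})"
    by (auto simp: young_diagram_def)
  then show ?thesis by simp
qed

lemma down_closed_eq_lessThan:
  assumes "finite (S :: nat set)" "\<And>x y. x \<in> S \<Longrightarrow> y \<le> x \<Longrightarrow> y \<in> S"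
  shows "S = {..<card S}"
proof -
  have "\<exists>n. S = {..<n}"
  proof (cases "S = {}")
    case False
    then have "S = {..<Suc (Max S)}"
      using assms by (auto simp: less_Suc_eq_le) (meson Max_in assms(2) False)
    then show ?thesis by blast
  qed auto
  then show ?thesis by auto
qed

lemma young_diagram_inj:
  assumes "is_partition \<pi>" "is_partition \<rho>" "young_diagram \<pi> = young_diagram \<rho>"
  shows "\<pi> = \<rho>"
proof -
  have row: "{j. (i, j) \<in> young_diagram \<sigma>} = (if i < length \<sigma> then {..<\<sigma> ! i} else {})" for i \<sigma>
    by (auto simp: young_diagram_def)
  have col: "{i. (i, 0) \<in> young_diagram \<sigma>} = {..<length \<sigma>}" if "is_partition \<sigma>" for \<sigma>
    using that by (auto simp: young_diagram_def is_partition_def) (metis gr0I nth_mem)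
  have len: "length \<pi> = length \<rho>"
    using col[OF assms(1)] col[OF assms(2)] assms(3) by (metis card_lessThan)
  moreover have "\<pi> ! i = \<rho> ! i" if "i < length \<pi>" for i
    using row[of i \<pi>] row[of i \<rho>] assms(3) that len by (metis card_lessThan)
  ultimately show ?thesis by (rule nth_equalityI)
qed

lemma length_frobenius:
  "length (frobenius_arms \<pi>) = diagonal_length \<pi>" "length (frobenius_legs \<pi>) = diagonal_length \<pi>"
  by (auto simp: frobenius_arms_def frobenius_legs_def)

lemma diagonal_boxes:
  assumes "is_partition \<pi>"
  shows "(i, i) \<in> young_diagram \<pi> \<longleftrightarrow> i < diagonal_length \<pi>"
proof -
  have "finite {i. (i, i) \<in> young_diagram \<pi>}"
    by (rule finite_subset[OF _ finite_imageI[OF finite_young_diagram[of \<pi>], of fst]]) force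
  then have "{i. (i, i) \<in> young_diagram \<pi>} = {..<diagonal_length \<pi>}"
    unfolding diagonal_length_def
    by (rule down_closed_eq_lessThan) (auto intro: young_diagram_down[OF assms])
  then show ?thesis by auto
qed

lemma finite_row_col:
  "finite {j. P j \<and> (i, j) \<in> young_diagram \<pi>}" "finite {j. P j \<and> (j, i) \<in> young_diagram \<pi>}"
  by (rule finite_subset[OF _ finite_imageI[OF finite_young_diagram[of \<pi>], of snd]], force)
     (rule finite_subset[OF _ finite_imageI[OF finite_young_diagram[of \<pi>], of fst]], force)

lemma interval_of_card:
  assumes fin: "finite {j. i < j \<and> Q j}" and down: "\<And>j j'. Q j \<Longrightarrow> j' \<le> j \<Longrightarrow> Q j'"
    and "i < j"
  shows "Q j \<longleftrightarrow> j \<le> i + card {j. i < j \<and> Q j}"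
proof -
  let ?S = "{k. Q (Suc (i + k))}"
  have img: "{j. i < j \<and> Q j} = (\<lambda>k. Suc (i + k)) ` ?S"
    by (auto simp: image_iff dest: less_imp_Suc_add)
  have inj: "inj_on (\<lambda>k. Suc (i + k)) ?S" by (auto simp: inj_on_def)
  have "finite ?S" using fin inj unfolding img by (rule finite_imageD)
  then have S: "?S = {..<card ?S}" by (rule down_closed_eq_lessThan) (auto intro: down)
  have c: "card {j. i < j \<and> Q j} = card ?S" unfolding img by (rule card_image[OF inj])
  obtain k where k: "j = Suc (i + k)" using \<open>i < j\<close> less_imp_Suc_add by blast
  have "Q j \<longleftrightarrow> k \<in> ?S" using k by simp
  also have "\<dots> \<longleftrightarrow> k < card ?S" using S by (metis lessThan_iff)
  finally show ?thesis using k c by auto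
qed

lemma young_diagram_frobenius:
  assumes "is_partition \<pi>"
  shows "(i, j) \<in> young_diagram \<pi> \<longleftrightarrow>
    (if i \<le> j then i < diagonal_length \<pi> \<and> j \<le> i + frobenius_arms \<pi> ! i
     else j < diagonal_length \<pi> \<and> i \<le> j + frobenius_legs \<pi> ! j)"
proof -
  note d = young_diagram_down[OF assms] and diag = diagonal_boxes[OF assms]
  consider "i = j" | "i < j" | "j < i" by linarith
  then show ?thesis
  proof cases
    case 1 then show ?thesis by (simp add: diag)
  next
    case 2
    have "(i, j) \<in> young_diagram \<pi> \<Longrightarrow> i < diagonal_length \<pi>"
      using 2 d[of i j i i] diag by auto
    moreover have "(i, j) \<in> young_diagram \<pi> \<longleftrightarrow>
        j \<le> i + card {j. i < j \<and> (i, j) \<in> young_diagram \<pi>}"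
      by (rule interval_of_card[OF finite_row_col(1) _ 2]) (auto intro: d)
    ultimately show ?thesis using 2 by (auto simp: frobenius_arms_def)
  next
    case 3
    have "(i, j) \<in> young_diagram \<pi> \<Longrightarrow> j < diagonal_length \<pi>"
      using 3 d[of i j j j] diag by auto
    moreover have "(i, j) \<in> young_diagram \<pi> \<longleftrightarrow>
        i \<le> j + card {i. j < i \<and> (i, j) \<in> young_diagram \<pi>}"
      by (rule interval_of_card[OF finite_row_col(2) _ 3]) (auto intro: d)
    ultimately show ?thesis using 3 by (auto simp: frobenius_legs_def)
  qed
qed

lemma frobenius_coordinates_inj:
  assumes "is_partition \<pi>" "is_partition \<rho>"
    "frobenius_arms \<pi> = frobenius_arms \<rho>" "frobenius_legs \<pi> = frobenius_legs \<rho>"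
  shows "\<pi> = \<rho>"
proof -
  have "diagonal_length \<pi> = diagonal_length \<rho>" using length_frobenius(1) assms(3) by metis
  then have "young_diagram \<pi> = young_diagram \<rho>"
    using young_diagram_frobenius[OF assms(1)] young_diagram_frobenius[OF assms(2)] assms(3,4)
    by (auto simp del: if_split)
  then show ?thesis using young_diagram_inj assms by blast
qed

lemma frobenius_partition_unique:
  assumes "is_partition \<pi>"
  shows "frobenius_partition (frobenius_arms \<pi>) (frobenius_legs \<pi>) = \<pi>"
  unfolding frobenius_partition_def
  using assms by (intro the_equality) (auto intro: frobenius_coordinates_inj)

lemma ex_partition_diagram:
  assumes fin: "finite Y" and down: "\<And>i j i' j'. (i, j) \<in> Y \<Longrightarrow> i' \<le> i \<Longrightarrow> j' \<le> j \<Longrightarrow> (i', j') \<in> Y"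
  shows "\<exists>\<pi>. is_partition \<pi> \<and> young_diagram \<pi> = Y"
proof -
  define row where "row i = {j. (i, j) \<in> Y}" for i
  define l where "l = card {i. (i, 0) \<in> Y}"
  have finr: "finite (row i)" for i
    unfolding row_def by (rule finite_subset[OF _ finite_imageI[OF fin, of snd]]) force
  have row: "row i = {..<card (row i)}" for i
    by (rule down_closed_eq_lessThan[OF finr]) (auto simp: row_def intro: down)
  have "finite {i. (i, 0) \<in> Y}"
    by (rule finite_subset[OF _ finite_imageI[OF fin, of fst]]) force
  then have l: "{i. (i, 0) \<in> Y} = {..<l}"
    unfolding l_def by (rule down_closed_eq_lessThan) (auto intro: down)
  have mem: "(i, j) \<in> Y \<longleftrightarrow> j < card (row i)" for i j
    using row[of i] unfolding row_def by blast
  have l': "0 < card (row i) \<longleftrightarrow> i < l" for i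
    unfolding mem[of i 0, symmetric] using l by blast
  define \<pi> where "\<pi> = map (\<lambda>i. card (row i)) [0..<l]"
  have "card (row i') \<le> card (row i)" if "i \<le> i'" for i i'
    by (rule card_mono[OF finr]) (use that in \<open>auto simp: row_def intro: down\<close>)
  moreover have "0 < card (row i)" if "i < l" for i
    using l'[of i] that by blast
  ultimately have "is_partition \<pi>"
    by (auto simp: is_partition_def \<pi>_def sorted_wrt_iff_nth_less) (metis less_irrefl)
  moreover have "young_diagram \<pi> = Y"
  proof -
    have "i < l" if "j < card (row i)" for i j
      using that l'[of i] by linarith
    then show ?thesis unfolding young_diagram_def \<pi>_def by (auto simp: mem)
  qed
  ultimately show ?thesis by blast
qed

lemma frobenius_partition_exists:
  assumes "length \<alpha> = length \<beta>" "sorted_wrt (>) \<alpha>" "sorted_wrt (>) \<beta>"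
  shows "\<exists>\<pi>. is_partition \<pi> \<and> frobenius_arms \<pi> = \<alpha> \<and> frobenius_legs \<pi> = \<beta>"
proof -
  define r where "r = length \<alpha>"
  define Y where "Y = {(i, j). if i \<le> j then i < r \<and> j \<le> i + \<alpha> ! i else j < r \<and> i \<le> j + \<beta> ! j}"
  have mono: "k' + xs ! k' \<ge> k + xs ! k"
    if "sorted_wrt (>) xs" "k' \<le> k" "k < length xs" for k k' and xs :: "nat list"
    using that(2,3)
  proof (induction k rule: dec_induct)
    case (step n)
    then have "xs ! n > xs ! Suc n" using that(1) by (auto simp: sorted_wrt_iff_nth_less)
    then show ?case using step by auto
  qed simp
  have down: "(i', j') \<in> Y" if "(i, j) \<in> Y" "i' \<le> i" "j' \<le> j" for i j i' j'
  proof -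
    consider "i \<le> j" "i' \<le> j'" | "i \<le> j" "j' < i'" | "j < i" "i' \<le> j'" | "j < i" "j' < i'"
      by linarith
    then show ?thesis
    proof cases
      case 1 then show ?thesis
        using that mono[OF assms(2), of i' i] by (auto simp: Y_def r_def)
    next
      case 2
      then have "i < r" using that by (auto simp: Y_def)
      moreover have "r - 1 \<le> j' + \<beta> ! j'" if "j' < r"
        using mono[OF assms(3), of j' "r - 1"] that assms(1)
        unfolding r_def by linarith
      ultimately show ?thesis using that 2 by (auto simp: Y_def)
    next
      case 3
      then have "j < r" using that by (auto simp: Y_def)
      moreover have "r - 1 \<le> i' + \<alpha> ! i'" if "i' < r"
        using mono[OF assms(2), of i' "r - 1"] that unfolding r_def by linarith
      ultimately show ?thesis using that 3 by (auto simp: Y_def)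
    next
      case 4 then show ?thesis
        using that mono[OF assms(3), of j' j] assms(1) by (auto simp: Y_def r_def)
    qed
  qed
  have "finite Y"
  proof (rule finite_subset)
    show "Y \<subseteq> (\<Union>i<r. {i} \<times> {..i + \<alpha> ! i}) \<union> (\<Union>j<r. {..j + \<beta> ! j} \<times> {j})"
      by (auto simp: Y_def split: if_splits)
  qed auto
  then obtain \<pi> where \<pi>: "is_partition \<pi>" "young_diagram \<pi> = Y"
    using ex_partition_diagram[of Y] down by blast
  have "{i. (i, i) \<in> Y} = {..<r}" by (auto simp: Y_def)
  then have dl: "diagonal_length \<pi> = r" by (simp add: diagonal_length_def \<pi>)
  have "{j. i < j \<and> (i, j) \<in> Y} = {i<..i + \<alpha> ! i}" "{j. i < j \<and> (j, i) \<in> Y} = {i<..i + \<beta> ! i}"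
    if "i < r" for i using that by (auto simp: Y_def)
  then have "frobenius_arms \<pi> = \<alpha>" "frobenius_legs \<pi> = \<beta>"
    using assms(1) by (auto simp: frobenius_arms_def frobenius_legs_def dl \<pi>(2) r_def intro!: nth_equalityI)
  then show ?thesis using \<pi>(1) by blast
qed


section \<open>Modules over the general linear Lie algebra\<close>

text \<open>
  The Lie algebra consists of the complex \<open>n \<times> n\<close> matrices with the commutator bracket. The
  module is a subspace \<open>V\<close> of an ambient complex vector space (of arbitrary dimension), so that
  its dimension is not tied to a type; nothing is required of \<open>act\<close> outside \<open>carrier_mat n n\<close>
  and \<open>V\<close>.
\<close>

locale gl_module = vector_space scale
  for scale :: "complex \<Rightarrow> 'v::ab_group_add \<Rightarrow> 'v" (infixr "*s" 75) +
  fixes n :: nat and V :: "'v set" and act :: "complex mat \<Rightarrow> 'v \<Rightarrow> 'v"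
  assumes subspace_V: "subspace V"
    and act_closed: "A \<in> carrier_mat n n \<Longrightarrow> v \<in> V \<Longrightarrow> act A v \<in> V"
    and act_add_right:
      "A \<in> carrier_mat n n \<Longrightarrow> v \<in> V \<Longrightarrow> w \<in> V \<Longrightarrow> act A (v + w) = act A v + act A w"
    and act_scale_right:
      "A \<in> carrier_mat n n \<Longrightarrow> v \<in> V \<Longrightarrow> act A (c *s v) = c *s act A v"
    and act_add_left:
      "A \<in> carrier_mat n n \<Longrightarrow> B \<in> carrier_mat n n \<Longrightarrow> v \<in> V \<Longrightarrow>
        act (A + B) v = act A v + act B v"
    and act_smult_left:
      "A \<in> carrier_mat n n \<Longrightarrow> v \<in> V \<Longrightarrow> act (c \<cdot>\<^sub>m A) v = c *s act A v"
    and act_bracket: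
      "A \<in> carrier_mat n n \<Longrightarrow> B \<in> carrier_mat n n \<Longrightarrow> v \<in> V \<Longrightarrow>
        act (A * B - B * A) v = act A (act B v) - act B (act A v)"
begin

definition finite_dim :: bool where
  "finite_dim \<longleftrightarrow> (\<exists>B. finite B \<and> span B = V)"

definition submodule :: "'v set \<Rightarrow> bool" where
  "submodule W \<longleftrightarrow>
     subspace W \<and> W \<subseteq> V \<and> (\<forall>A \<in> carrier_mat n n. \<forall>w \<in> W. act A w \<in> W)"

definition simple :: bool where
  "simple \<longleftrightarrow> V \<noteq> {0} \<and> (\<forall>W. submodule W \<longrightarrow> W = {0} \<or> W = V)"

text \<open>
  Highest weights are taken with respect to the diagonal Cartan subalgebra and the upper
  triangular Borel subalgebra. That \<open>v\<close> generates \<open>V\<close> is not part of the definition; it is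
  automatic for simple modules.
\<close>

definition highest_weight_vector :: "int list \<Rightarrow> 'v \<Rightarrow> bool" where
  "highest_weight_vector \<mu> v \<longleftrightarrow> v \<in> V \<and> v \<noteq> 0 \<and>
     (\<forall>A \<in> carrier_mat n n. (\<forall>i<n. \<forall>j\<le>i. A $$ (i, j) = 0) \<longrightarrow> act A v = 0) \<and>
     (\<forall>H \<in> carrier_mat n n. diagonal_mat H \<longrightarrow>
        act H v = (\<Sum>i<n. of_int (\<mu> ! i) * H $$ (i, i)) *s v)"

definition has_highest_weight :: "int list \<Rightarrow> bool" where
  "has_highest_weight \<mu> \<longleftrightarrow> length \<mu> = n \<and> (\<exists>v. highest_weight_vector \<mu> v)"

end

text \<open>
  A model of the module \<open>F\<close> with superscript \<open>n\<close> and subscript \<open>\<mu>\<close>, which is determined up to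
  isomorphism.
\<close>

locale simple_gl_module = gl_module scale n V act
  for scale :: "complex \<Rightarrow> 'v::ab_group_add \<Rightarrow> 'v" (infixr "*s" 75)
    and n :: nat and V :: "'v set" and act :: "complex mat \<Rightarrow> 'v \<Rightarrow> 'v" +
  fixes \<mu> :: "int list"
  assumes dominant: "sorted_wrt (\<ge>) \<mu>"
    and finite_dim: finite_dim
    and simple: simple
    and highest_weight: "has_highest_weight \<mu>"

end

theory Submission
  imports Defs "Jordan_Normal_Form.Determinant"
begin

text \<open>
  Write \<open>dim(n, \<lambda>)\<close> for the dimension of the simple \<open>gl\<^sub>n\<close>-module whose highest weight is the
  partition \<open>\<lambda>\<close>. The identity is a consequence of the hook content formula
  \<open>dim(n, \<lambda>) * H(\<lambda>) = C(n, \<lambda>)\<close>, where \<open>H(\<lambda>)\<close> is the product of the hook lengths of \<open>\<lambda>\<close> and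
  \<open>C(n, \<lambda>)\<close> is the product of \<open>n + j - i\<close> over all boxes \<open>(i, j)\<close>. In Frobenius coordinates the boxes
  of the \<open>k\<close>-th diagonal hook have the contents \<open>- \<beta>\<^sub>k, ..., \<alpha>\<^sub>k\<close>, so enlarging the arms by \<open>m\<close> in
  \<open>gl\<^sub>n\<close> and enlarging the legs by \<open>m\<close> in \<open>gl\<^sub>n\<^sub>+\<^sub>m\<close> give the same factors
  (\<open>content_product_shift\<close>). Hence the first and the third module have equal content products,
  and so have the second and the fourth. Exchanging arms and legs transposes the diagram and preserves the
  hook lengths (\<open>hook_product_transposed\<close>), so the first partition has the same hook product as
  the fourth, and the second the same as the third. The hook products therefore cancel.

  The hook content formula is a rewriting of Weyl's dimension formula
  \<open>dim(n, \<lambda>) = \<Prod> (l\<^sub>i - l\<^sub>j) / (j - i)\<close>, \<open>i < j < n\<close>, with \<open>l\<^sub>i = \<lambda>\<^sub>i + n - 1 - i\<close>: the hook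
  lengths in row \<open>i\<close> together with the differences \<open>l\<^sub>i - l\<^sub>k\<close>, \<open>k > i\<close>, are exactly the numbers
  \<open>1, ..., l\<^sub>i\<close> (\<open>hooks_of_row\<close>).

  Weyl's formula is proved with the Casimir operator. A simple module \<open>V\<close> with a highest weight
  vector is spanned by the vectors obtained from it by applying lowering operators, so it has a basis of weight
  vectors, all weights are below the highest one, and the highest weight has multiplicity one
  (\<open>weight_basis\<close>). The weight multiplicities are symmetric under permutations of the coordinates
  (\<open>weight_multiplicity_reflect\<close>). The Casimir operator is a scalar on \<open>V\<close>; taking its trace
  against the monomials \<open>x\<^sup>\<mu>\<close> gives a differential equation for the character \<open>P(x)\<close>
  (\<open>casimir_trace\<close>), in which derivatives appear as weights multiplying the monomials. After
  multiplication by the Vandermonde product \<open>D(x)\<close> this equation says that \<open>D P\<close> is an eigenfunction of the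
  flat Laplacian: every exponent \<open>\<mu>\<close> occurring in \<open>D P\<close> has the same norm as \<open>l\<close>
  (\<open>alternant_eigenfunction\<close>, \<open>coef_eigen\<close>). As \<open>D P\<close> is antisymmetric and its exponents are
  dominated by \<open>l\<close>, only the permutations of \<open>l\<close> are left (\<open>coef_nonzero_imp_permuted\<close>). This is Weyl's
  character formula, and the specialization \<open>x\<^sub>i = r\<^sup>i\<close>, \<open>r \<rightarrow> 1\<close>, turns it into the dimension
  formula (\<open>weyl_dimension\<close>).
\<close>

section \<open>Hooks, contents and Frobenius coordinates\<close>

definition transposed :: "nat list \<Rightarrow> nat list \<Rightarrow> bool" where
  "transposed \<pi> \<rho> \<longleftrightarrow> (\<forall>i j. (i, j) \<in> young_diagram \<pi> \<longleftrightarrow> (j, i) \<in> young_diagram \<rho>)"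

definition hook :: "nat list \<Rightarrow> nat \<times> nat \<Rightarrow> nat" where
  "hook \<pi> = (\<lambda>(i, j). card {j'. j \<le> j' \<and> (i, j') \<in> young_diagram \<pi>} + card {i'. i < i' \<and> (i', j) \<in> young_diagram \<pi>})"

definition hook_product :: "nat list \<Rightarrow> nat" where
  "hook_product \<pi> = (\<Prod>x\<in>young_diagram \<pi>. hook \<pi> x)"

text \<open>
  The content \<open>j - i\<close> is shifted by \<open>n\<close> in the integers, since the factor may be nonpositive when the
  diagram has more than \<open>n\<close> rows.
\<close>
definition content_product :: "nat \<Rightarrow> nat list \<Rightarrow> int" where
  "content_product n \<pi> = (\<Prod>(i, j)\<in>young_diagram \<pi>. int n + int j - int i)"

text \<open>
  Rows below the diagram are given length \<open>0\<close>, so that all \<open>n\<close> entries of the weight are covered.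
\<close>
definition row_length :: "nat list \<Rightarrow> nat \<Rightarrow> nat" where
  "row_length \<pi> i = (if i < length \<pi> then \<pi> ! i else 0)"

definition column_length :: "nat list \<Rightarrow> nat \<Rightarrow> nat" where
  "column_length \<pi> j = card {i. (i, j) \<in> young_diagram \<pi>}"

lemma mem_young_diagram_row: "(i, j) \<in> young_diagram \<pi> \<longleftrightarrow> j < row_length \<pi> i"
  by (auto simp: young_diagram_def row_length_def)

lemma mem_young_diagram_column:
  assumes "is_partition \<pi>"
  shows "(i, j) \<in> young_diagram \<pi> \<longleftrightarrow> i < column_length \<pi> j"
proof -
  have "finite {i. (i, j) \<in> young_diagram \<pi>}"
    using finite_row_col(2)[of "\<lambda>_. True" j \<pi>] by simp
  then have "{i. (i, j) \<in> young_diagram \<pi>} = {..<column_length \<pi> j}"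
    unfolding column_length_def
    by (rule down_closed_eq_lessThan) (auto intro: young_diagram_down[OF assms])
  then show ?thesis by blast
qed

lemma row_length_antimono: "is_partition \<pi> \<Longrightarrow> i \<le> i' \<Longrightarrow> row_length \<pi> i' \<le> row_length \<pi> i"
  using young_diagram_down[of \<pi> i' "row_length \<pi> i" i "row_length \<pi> i"] mem_young_diagram_row[of _ _ \<pi>]
  by (meson not_less order_refl)

lemma column_length_antimono: "is_partition \<pi> \<Longrightarrow> j \<le> j' \<Longrightarrow> column_length \<pi> j' \<le> column_length \<pi> j"
  using young_diagram_down[of \<pi> "column_length \<pi> j" j' "column_length \<pi> j" j] mem_young_diagram_column[of \<pi>]
  by (meson not_less order_refl)

lemma column_le_length: "is_partition \<pi> \<Longrightarrow> column_length \<pi> j \<le> length \<pi>"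
  using mem_young_diagram_column[of \<pi> "length \<pi>" j] by (auto simp: young_diagram_def)

lemma hook_eq:
  assumes "is_partition \<pi>" "(i, j) \<in> young_diagram \<pi>"
  shows "int (hook \<pi> (i, j)) = int (row_length \<pi> i) - int j + int (column_length \<pi> j) - int i - 1"
proof -
  have "{j'. j \<le> j' \<and> (i, j') \<in> young_diagram \<pi>} = {j..<row_length \<pi> i}"
    by (auto simp: mem_young_diagram_row)
  moreover have "{i'. i < i' \<and> (i', j) \<in> young_diagram \<pi>} = {i<..<column_length \<pi> j}"
    by (auto simp: mem_young_diagram_column[OF assms(1)])
  moreover have "j < row_length \<pi> i" "i < column_length \<pi> j"
    using assms mem_young_diagram_row mem_young_diagram_column by auto
  ultimately show ?thesis by (simp add: hook_def)
qed

lemma hook_product_pos: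
  assumes "is_partition \<pi>"
  shows "hook_product \<pi> > 0"
  unfolding hook_product_def
proof (intro prod_pos ballI)
  fix x assume x: "x \<in> young_diagram \<pi>"
  obtain i j where ij: "x = (i, j)" by force
  have "j < row_length \<pi> i" "i < column_length \<pi> j"
    using assms x ij mem_young_diagram_row mem_young_diagram_column by auto
  moreover have "int (hook \<pi> x) = int (row_length \<pi> i) - int j + int (column_length \<pi> j) - int i - 1"
    using hook_eq[OF assms, of i j] x ij by simp
  ultimately show "0 < hook \<pi> x" by linarith
qed

lemma hook_product_transposed:
  assumes "is_partition \<pi>" "is_partition \<rho>" "transposed \<pi> \<rho>"
  shows "hook_product \<pi> = hook_product \<rho>"
  unfolding hook_product_def
proof (rule prod.reindex_bij_witness[where i = prod.swap and j = prod.swap])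
  fix x assume x: "x \<in> young_diagram \<pi>"
  obtain i j where ij: "x = (i, j)" by force
  have t: "(i, j) \<in> young_diagram \<pi> \<longleftrightarrow> (j, i) \<in> young_diagram \<rho>" for i j
    using assms(3) by (simp add: transposed_def)
  show "prod.swap x \<in> young_diagram \<rho>" using x t by (simp add: ij)
  have "{i'. (i', i) \<in> young_diagram \<rho>} = {j'. (i, j') \<in> young_diagram \<pi>}"
    by (simp only: t)
  then have "row_length \<pi> i = column_length \<rho> i"
    unfolding column_length_def by (simp add: mem_young_diagram_row)
  moreover have "{i'. (i', j) \<in> young_diagram \<pi>} = {i'. (j, i') \<in> young_diagram \<rho>}"
    by (simp only: t)
  then have "row_length \<rho> j = column_length \<pi> j"
    unfolding column_length_def by (simp add: mem_young_diagram_row)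
  moreover have "int (hook \<rho> (j, i)) = int (row_length \<rho> j) - int i + int (column_length \<rho> i) - int j - 1"
    using x t by (intro hook_eq[OF assms(2)]) (simp add: ij)
  ultimately have "int (hook \<rho> (j, i)) = int (hook \<pi> (i, j))"
    using hook_eq[OF assms(1), of i j] x unfolding ij by linarith
  then show "hook \<rho> (prod.swap x) = hook \<pi> x" by (simp add: ij)
next
  fix x assume "x \<in> young_diagram \<rho>"
  then show "prod.swap x \<in> young_diagram \<pi>" using assms(3) by (cases x) (simp add: transposed_def)
qed auto

text \<open>
  Both families are strictly monotone, lie between \<open>1\<close> and \<open>N = \<lambda>\<^sub>i + n - 1 - i\<close>, and have \<open>N\<close>
  members together. A hook length equals \<open>L i - L k\<close> for no \<open>k\<close>: the box \<open>(k, j)\<close> is inside or outside the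
  diagram, and accordingly the hook length is too small or too large. So together they run through \<open>1, ..., N\<close>.
\<close>
lemma hooks_of_row:
  assumes \<pi>: "is_partition \<pi>" and n: "length \<pi> \<le> n" and i: "i < n"
  defines "L \<equiv> \<lambda>k. int (row_length \<pi> k) + (int n - 1 - int k)"
  shows "(\<Prod>j = 0..<row_length \<pi> i. int (hook \<pi> (i, j))) * (\<Prod>k = Suc i..<n. L i - L k) = fact (row_length \<pi> i + (n - 1 - i))"
proof -
  define h where "h j = int (hook \<pi> (i, j))" for j
  define d where "d k = L i - L k" for k
  define N where "N = row_length \<pi> i + (n - 1 - i)"
  have h: "h j = int (row_length \<pi> i) - int j + int (column_length \<pi> j) - int i - 1" "i < column_length \<pi> j" if "j < row_length \<pi> i" for j
  proof -
    have "(i, j) \<in> young_diagram \<pi>" using that by (simp add: mem_young_diagram_row)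
    then show "h j = int (row_length \<pi> i) - int j + int (column_length \<pi> j) - int i - 1" "i < column_length \<pi> j"
      using hook_eq[OF \<pi>] mem_young_diagram_column[OF \<pi>] by (auto simp: h_def)
  qed
  have d: "d k = int (row_length \<pi> i) - int (row_length \<pi> k) + int k - int i" for k
    by (simp add: d_def L_def)
  have h_less: "h j' < h j" if "j < j'" "j' < row_length \<pi> i" for j j'
    using h(1)[of j] h(1)[of j'] column_length_antimono[OF \<pi>, of j j'] that by linarith
  have d_less: "d k < d k'" if "k < k'" for k k'
    using d[of k] d[of k'] row_length_antimono[OF \<pi>, of k k'] that by linarith
  have inj_h: "inj_on h {0..<row_length \<pi> i}"
  proof (rule inj_onI)
    fix j j' assume "j \<in> {0..<row_length \<pi> i}" "j' \<in> {0..<row_length \<pi> i}" "h j = h j'"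
    then show "j = j'" using h_less[of j j'] h_less[of j' j] by (cases j j' rule: linorder_cases) auto
  qed
  have inj_d: "inj_on d {Suc i..<n}"
  proof (rule inj_onI)
    fix k k' assume "d k = d k'"
    then show "k = k'" using d_less[of k k'] d_less[of k' k] by (cases k k' rule: linorder_cases) auto
  qed
  have disj: "h ` {0..<row_length \<pi> i} \<inter> d ` {Suc i..<n} = {}"
  proof -
    have "h j \<noteq> d k" if j: "j < row_length \<pi> i" for j k
    proof (cases "j < row_length \<pi> k")
      case True
      then have "k < column_length \<pi> j"
        using mem_young_diagram_column[OF \<pi>] mem_young_diagram_row by blast
      then show ?thesis using h(1)[OF j] d[of k] True by linarith
    next
      case False
      then have "\<not> k < column_length \<pi> j"
        using mem_young_diagram_column[OF \<pi>] mem_young_diagram_row by blast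
      then show ?thesis using h(1)[OF j] d[of k] False by linarith
    qed
    then show ?thesis by auto
  qed
  have sub: "h ` {0..<row_length \<pi> i} \<union> d ` {Suc i..<n} \<subseteq> {1..int N}"
  proof -
    have "h j \<in> {1..int N}" if "j < row_length \<pi> i" for j
      using h[OF that] column_le_length[OF \<pi>, of j] n i that by (auto simp: N_def)
    moreover have "d k \<in> {1..int N}" if "Suc i \<le> k" "k < n" for k
      using d[of k] row_length_antimono[OF \<pi>, of i k] that i by (auto simp: N_def)
    ultimately show ?thesis by auto
  qed
  have "card (h ` {0..<row_length \<pi> i} \<union> d ` {Suc i..<n}) = N"
    using i by (subst card_Un_disjoint[OF _ _ disj]) (simp_all add: card_image inj_h inj_d N_def)
  then have "h ` {0..<row_length \<pi> i} \<union> d ` {Suc i..<n} = {1..int N}"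
    using sub by (intro card_subset_eq) auto
  moreover have "(\<Prod>z\<in>h ` {0..<row_length \<pi> i} \<union> d ` {Suc i..<n}. z) =
      (\<Prod>j = 0..<row_length \<pi> i. h j) * (\<Prod>k = Suc i..<n. d k)"
    by (subst prod.union_disjoint[OF _ _ disj]) (simp_all add: prod.reindex inj_h inj_d)
  moreover have "(\<Prod>z = 1..int N. z) = fact N"
  proof -
    have "(\<Prod>z = 1..int N. z) = (\<Prod>k = 1..N. int k)"
      by (rule prod.reindex_bij_witness[where i = int and j = nat]) auto
    then show ?thesis by (simp add: fact_prod)
  qed
  ultimately show ?thesis by (simp add: h_def d_def N_def)
qed

lemma prod_pairs_swap:
  fixes f :: "nat \<Rightarrow> nat \<Rightarrow> 'a :: comm_monoid_mult"
  shows "(\<Prod>j = 0..<n. \<Prod>i = 0..<j. f i j) = (\<Prod>i = 0..<n. \<Prod>j = Suc i..<n. f i j)"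
  unfolding prod.Sigma[OF finite_atLeastLessThan ballI[OF finite_atLeastLessThan]]
  by (rule prod.reindex_bij_witness[where i = prod.swap and j = prod.swap]) auto

lemma young_diagram_Sigma:
  assumes "length \<pi> \<le> n"
  shows "young_diagram \<pi> = (SIGMA i:{0..<n}. {0..<row_length \<pi> i})"
  using assms by (auto simp: young_diagram_def row_length_def split: if_splits)

text \<open>
  The hypothesis on \<open>D\<close> is Weyl's dimension formula with denominators cleared. Multiplying by the hook
  product turns the numerator into a product of factorials, and \<open>(\<lambda>\<^sub>i + n - 1 - i)! / (n - 1 - i)!\<close> is the
  product of \<open>n + j - i\<close> over row \<open>i\<close>.
\<close>
lemma hook_content:
  assumes \<pi>: "is_partition \<pi>" and n: "length \<pi> \<le> n"
    and dim: "(\<Prod>j = 0..<n. \<Prod>i = 0..<j. int j - int i) * D =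
      (\<Prod>j = 0..<n. \<Prod>i = 0..<j. (int (row_length \<pi> i) + (int n - 1 - int i)) - (int (row_length \<pi> j) + (int n - 1 - int j)))"
  shows "D * int (hook_product \<pi>) = content_product n \<pi>"
proof -
  let ?L = "\<lambda>k. int (row_length \<pi> k) + (int n - 1 - int k)"
  define V where "V = (\<Prod>i = 0..<n. \<Prod>k = Suc i..<n. int k - int i)"
  have dim': "V * D = (\<Prod>i = 0..<n. \<Prod>k = Suc i..<n. ?L i - ?L k)"
    using dim unfolding prod_pairs_swap V_def .
  have hooks: "int (hook_product \<pi>) = (\<Prod>i = 0..<n. \<Prod>j = 0..<row_length \<pi> i. int (hook \<pi> (i, j)))"
    unfolding hook_product_def young_diagram_Sigma[OF n] of_nat_prod by (simp add: prod.Sigma)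
  have contents: "content_product n \<pi> = (\<Prod>i = 0..<n. \<Prod>j = 0..<row_length \<pi> i. int n + int j - int i)"
    unfolding content_product_def young_diagram_Sigma[OF n] by (simp add: prod.Sigma)
  have V: "V = (\<Prod>i = 0..<n. fact (n - 1 - i))"
    unfolding V_def
  proof (intro prod.cong refl)
    fix i assume "i \<in> {0..<n}"
    have "(\<Prod>k = Suc i..<n. int k - int i) = (\<Prod>k = 1..n - 1 - i. int k)"
      using \<open>i \<in> {0..<n}\<close>
      by (intro prod.reindex_bij_witness[where i = "\<lambda>k. k + i" and j = "\<lambda>k. k - i"]) auto
    then show "(\<Prod>k = Suc i..<n. int k - int i) = fact (n - 1 - i)" by (simp add: fact_prod)
  qed
  have rowfact: "fact (row_length \<pi> i + (n - 1 - i)) = fact (n - 1 - i) * (\<Prod>j = 0..<row_length \<pi> i. int n + int j - int i)"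
    if "i < n" for i
  proof -
    have "(fact (r + (n - 1 - i)) :: int) = fact (n - 1 - i) * (\<Prod>j = 0..<r. int n + int j - int i)" for r
      using that by (induction r) (simp_all add: of_nat_diff algebra_simps)
    then show ?thesis .
  qed
  have "V * (D * int (hook_product \<pi>)) = (\<Prod>i = 0..<n. \<Prod>j = 0..<row_length \<pi> i. int (hook \<pi> (i, j))) * (\<Prod>i = 0..<n. \<Prod>k = Suc i..<n. ?L i - ?L k)"
    unfolding hooks dim'[symmetric] by (simp add: mult_ac)
  also have "\<dots> = (\<Prod>i = 0..<n. fact (row_length \<pi> i + (n - 1 - i)))"
    unfolding prod.distrib[symmetric] by (intro prod.cong refl hooks_of_row[OF \<pi> n]) simp
  also have "\<dots> = (\<Prod>i = 0..<n. fact (n - 1 - i) * (\<Prod>j = 0..<row_length \<pi> i. int n + int j - int i))"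
    by (intro prod.cong refl rowfact) simp
  also have "\<dots> = V * content_product n \<pi>"
    unfolding prod.distrib V contents ..
  finally show ?thesis by (simp add: V)
qed

lemma frobenius_coordinates_strict_decreasing:
  assumes "is_partition \<pi>"
  shows "sorted_wrt (>) (frobenius_arms \<pi>)" "sorted_wrt (>) (frobenius_legs \<pi>)"
proof -
  note d = young_diagram_frobenius[OF assms] and down = young_diagram_down[OF assms]
  let ?r = "diagonal_length \<pi>"
  have arms: "frobenius_arms \<pi> ! j < frobenius_arms \<pi> ! i" if "i < j" "j < ?r" for i j
  proof -
    have "(j, j + frobenius_arms \<pi> ! j) \<in> young_diagram \<pi>" unfolding d using that by simp
    then have "(i, j + frobenius_arms \<pi> ! j) \<in> young_diagram \<pi>" using that by (auto intro: down)
    then show ?thesis unfolding d using that by (simp split: if_splits)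
  qed
  have legs: "frobenius_legs \<pi> ! j < frobenius_legs \<pi> ! i" if "i < j" "j < ?r" for i j
  proof -
    have "(j + frobenius_legs \<pi> ! j, j) \<in> young_diagram \<pi>" unfolding d using that by simp
    then have "(j + frobenius_legs \<pi> ! j, i) \<in> young_diagram \<pi>" using that by (auto intro: down)
    then show ?thesis unfolding d using that by (simp split: if_splits)
  qed
  show "sorted_wrt (>) (frobenius_arms \<pi>)" "sorted_wrt (>) (frobenius_legs \<pi>)"
    using arms legs by (auto simp: sorted_wrt_iff_nth_less length_frobenius)
qed

lemma frobenius_partition:
  assumes "length \<alpha> = length \<beta>" "sorted_wrt (>) \<alpha>" "sorted_wrt (>) \<beta>"
  shows "is_partition (frobenius_partition \<alpha> \<beta>)"
    "frobenius_arms (frobenius_partition \<alpha> \<beta>) = \<alpha>" "frobenius_legs (frobenius_partition \<alpha> \<beta>) = \<beta>"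
    "diagonal_length (frobenius_partition \<alpha> \<beta>) = length \<alpha>"
proof -
  obtain \<pi> where \<pi>: "is_partition \<pi>" "frobenius_arms \<pi> = \<alpha>" "frobenius_legs \<pi> = \<beta>"
    using frobenius_partition_exists[OF assms] by blast
  then have "frobenius_partition \<alpha> \<beta> = \<pi>" using frobenius_partition_unique[OF \<pi>(1)] by simp
  then show "is_partition (frobenius_partition \<alpha> \<beta>)"
    "frobenius_arms (frobenius_partition \<alpha> \<beta>) = \<alpha>" "frobenius_legs (frobenius_partition \<alpha> \<beta>) = \<beta>"
    "diagonal_length (frobenius_partition \<alpha> \<beta>) = length \<alpha>"
    using \<pi> length_frobenius(1)[of \<pi>] by simp_all
qed

lemma frobenius_partition_transposed:
  assumes "length \<alpha> = length \<beta>" "sorted_wrt (>) \<alpha>" "sorted_wrt (>) \<beta>"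
  shows "transposed (frobenius_partition \<alpha> \<beta>) (frobenius_partition \<beta> \<alpha>)"
proof -
  note f = frobenius_partition[OF assms] and g = frobenius_partition[OF assms(1)[symmetric] assms(3,2)]
  show ?thesis
    unfolding transposed_def young_diagram_frobenius[OF f(1)] young_diagram_frobenius[OF g(1)] f(2-4) g(2-4)
    using assms(1) by auto
qed

text \<open>
  The diagram is the disjoint union of its diagonal hooks; the boxes of one hook have pairwise different
  contents, which fill an interval. The box \<open>(i, j)\<close> lies on the hook number \<open>min i j\<close>.
\<close>
lemma content_product_frobenius:
  assumes "length \<alpha> = length \<beta>" "sorted_wrt (>) \<alpha>" "sorted_wrt (>) \<beta>"
  shows "content_product n (frobenius_partition \<alpha> \<beta>) =
    (\<Prod>i = 0..<length \<alpha>. \<Prod>c = - int (\<beta> ! i)..int (\<alpha> ! i). int n + c)"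
proof -
  note f = frobenius_partition[OF assms]
  have mem: "(i, j) \<in> young_diagram (frobenius_partition \<alpha> \<beta>) \<longleftrightarrow>
      (if i \<le> j then i < length \<alpha> \<and> j \<le> i + \<alpha> ! i else j < length \<alpha> \<and> i \<le> j + \<beta> ! j)" for i j
    unfolding young_diagram_frobenius[OF f(1)] f(2-4) ..
  have "(\<Prod>i = 0..<length \<alpha>. \<Prod>c = - int (\<beta> ! i)..int (\<alpha> ! i). int n + c) =
      (\<Prod>(i, c)\<in>(SIGMA i:{0..<length \<alpha>}. {- int (\<beta> ! i)..int (\<alpha> ! i)}). int n + c)"
    by (simp add: prod.Sigma)
  also have "\<dots> = content_product n (frobenius_partition \<alpha> \<beta>)"
    unfolding content_product_def
    by (rule prod.reindex_bij_witness[where i = "\<lambda>(i, j). (min i j, int j - int i)"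
          and j = "\<lambda>(i, c). (i + nat (- c), i + nat c)"])
       (auto simp: mem min_def split: if_splits)
  finally show ?thesis by simp
qed

text \<open>
  Substituting \<open>c + m\<close> for \<open>c\<close> moves the interval of contents of each diagonal hook.
\<close>
lemma content_product_shift:
  assumes "length \<alpha> = length \<beta>" "sorted_wrt (>) \<alpha>" "sorted_wrt (>) \<beta>"
  shows "content_product n (frobenius_partition (map (\<lambda>a. a + m) \<alpha>) \<beta>) =
    content_product (n + m) (frobenius_partition \<alpha> (map (\<lambda>b. b + m) \<beta>))"
proof -
  have shift: "sorted_wrt (>) (map (\<lambda>a. a + m) xs)" if "sorted_wrt (>) xs" for xs :: "nat list"
    using that by (simp add: sorted_wrt_map)
  have "(\<Prod>c = - int (\<beta> ! i)..int (\<alpha> ! i + m). int n + c) = (\<Prod>c = - int (\<beta> ! i + m)..int (\<alpha> ! i). int (n + m) + c)" for i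
    by (rule prod.reindex_bij_witness[where i = "\<lambda>c. c + int m" and j = "\<lambda>c. c - int m"]) auto
  then show ?thesis
    using assms by (simp add: content_product_frobenius shift)
qed


section \<open>Alternants\<close>

lemma poly_eq_smult_prod_roots:
  fixes p :: "'a :: idom poly"
  assumes S: "finite S" and root: "\<And>s. s \<in> S \<Longrightarrow> poly p s = 0" and deg: "degree p \<le> card S"
  shows "p = smult (coeff p (card S)) (\<Prod>s\<in>S. [:- s, 1:])"
proof -
  define P where "P = p - smult (coeff p (card S)) (\<Prod>s\<in>S. [:- s, 1:])"
  have monic: "lead_coeff (\<Prod>s\<in>S. [:- s, 1:]) = 1"
    by (simp add: lead_coeff_prod)
  have dg: "degree (\<Prod>s\<in>S. [:- s, 1:]) = card S"
    by (subst degree_prod_eq_sum_degree) auto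
  have co: "coeff P k = 0" if "k \<ge> card S" for k
    using that monic dg deg by (cases "k = card S") (simp_all add: P_def coeff_eq_0)
  have "P = 0"
  proof (rule ccontr)
    assume "P \<noteq> 0"
    then have "degree P < card S" using co leading_coeff_0_iff not_less by blast
    have "poly P s = 0" if "s \<in> S" for s
      using that S by (auto simp: P_def root poly_prod intro!: prod_zero)
    then have "card S \<le> card {t. poly P t = 0}"
      using poly_roots_finite[OF \<open>P \<noteq> 0\<close>] by (intro card_mono) auto
    also have "\<dots> \<le> degree P" by (rule card_poly_roots_bound[OF \<open>P \<noteq> 0\<close>])
    finally show False using \<open>degree P < card S\<close> by simp
  qed
  then show ?thesis by (simp add: P_def)
qed

text \<open>
  The monomials of the alternant are the \<open>x\<^sup>w\<^sup>\<rho>\<close> for \<open>\<rho> = (0, ..., n - 1)\<close>: all exponents have the same norm.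
\<close>
definition alternant :: "nat \<Rightarrow> (nat \<Rightarrow> complex) \<Rightarrow> complex" where
  "alternant n x = (\<Sum>w | w permutes {0..<n}. signof w * (\<Prod>i = 0..<n. x i ^ w i))"

lemma alternant_eq_det: "alternant n x = det (mat n n (\<lambda>(i, j). x i ^ j))"
proof -
  have "(\<Prod>i = 0..<n. mat n n (\<lambda>(i, j). x i ^ j) $$ (i, p i)) = (\<Prod>i = 0..<n. x i ^ p i)"
    if "p permutes {0..<n}" for p
    using permutes_in_image[OF that] by (intro prod.cong) auto
  then show ?thesis unfolding alternant_def by (subst det_def'[of _ n]) auto
qed

lemma alternant_eq_0:
  assumes "i < n" "j < n" "i \<noteq> j" "x i = x j"
  shows "alternant n x = 0"
  unfolding alternant_eq_det
  by (rule det_identical_rows[of _ n i j]) (use assms in \<open>auto intro!: eq_vecI\<close>)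

text \<open>
  As a polynomial in the last variable the alternant has degree at most \<open>n\<close> and vanishes at the other
  \<open>n\<close> variables, because two rows of the determinant then agree.
\<close>
lemma alternant_Vandermonde:
  "inj_on x {0..<n} \<Longrightarrow> alternant n x = (\<Prod>j = 0..<n. \<Prod>i = 0..<j. x j - x i)"
proof (induction n)
  case 0
  show ?case by (simp add: alternant_eq_det)
next
  case (Suc n)
  define A where "A t = mat (Suc n) (Suc n) (\<lambda>(i, j). (x(n := t)) i ^ j)" for t
  define P where "P = (\<Sum>j\<le>n. monom (cofactor (A 0) n j) j)"
  have inj: "inj_on x {0..<n}" using Suc.prems by (rule inj_on_subset) auto
  have P: "poly P t = alternant (Suc n) (x(n := t))" for t
  proof -
    have cof: "cofactor (A t) n j = cofactor (A 0) n j" if "j \<le> n" for j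
    proof -
      have "mat_delete (A t) n j = mat_delete (A 0) n j"
        using that by (intro eq_matI) (auto simp: mat_delete_def A_def)
      then show ?thesis by (simp add: cofactor_def)
    qed
    have entry: "A t $$ (n, j) = t ^ j" if "j \<le> n" for j
      using that by (simp add: A_def)
    have "det (A t) = (\<Sum>j<Suc n. A t $$ (n, j) * cofactor (A t) n j)"
      by (rule laplace_expansion_row) (auto simp: A_def)
    also have "\<dots> = (\<Sum>j\<le>n. t ^ j * cofactor (A 0) n j)"
      unfolding lessThan_Suc_atMost by (rule sum.cong) (simp_all add: cof entry)
    finally show ?thesis
      by (simp add: P_def poly_sum poly_monom mult.commute alternant_eq_det A_def)
  qed
  have "degree P \<le> n"
    unfolding P_def by (intro degree_sum_le) (auto intro: order_trans[OF degree_monom_le])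
  moreover have "poly P s = 0" if "s \<in> x ` {0..<n}" for s
  proof -
    obtain i where "i \<in> {0..<n}" "s = x i" using \<open>s \<in> x ` {0..<n}\<close> by blast
    then show ?thesis unfolding P by (intro alternant_eq_0[of i _ n]) auto
  qed
  moreover have "card (x ` {0..<n}) = n" using inj by (simp add: card_image)
  ultimately have "P = smult (coeff P n) (\<Prod>s\<in>x ` {0..<n}. [:- s, 1:])"
    using poly_eq_smult_prod_roots[of "x ` {0..<n}" P] by simp
  then have "poly P (x n) = poly (smult (coeff P n) (\<Prod>s\<in>x ` {0..<n}. [:- s, 1:])) (x n)"
    by (rule arg_cong)
  then have "poly P (x n) = coeff P n * (\<Prod>i = 0..<n. x n - x i)"
    by (simp add: poly_prod prod.reindex[OF inj])
  moreover have "coeff P n = alternant n x"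
  proof -
    have "mat_delete (A 0) n n = mat n n (\<lambda>(i, j). x i ^ j)"
      by (intro eq_matI) (auto simp: mat_delete_def A_def)
    then show ?thesis by (simp add: P_def coeff_sum cofactor_def alternant_eq_det)
  qed
  moreover have "poly P (x n) = alternant (Suc n) x" by (simp add: P)
  ultimately show ?case using Suc.IH[OF inj] by simp
qed

text \<open>
  The left-hand side is \<open>x\<^sub>i\<close> times the partial derivative of the alternant with respect to \<open>x\<^sub>i\<close>. As a
  polynomial in \<open>x\<^sub>i\<close>, the alternant is a constant multiple of the product of all \<open>x\<^sub>i - x\<^sub>j\<close>.
\<close>
lemma alternant_log_derivative:
  assumes x: "inj_on x {0..<n}" and i: "i < n"
  shows "(\<Sum>w | w permutes {0..<n}. signof w * of_nat (w i) * (\<Prod>k = 0..<n. x k ^ w k)) =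
    alternant n x * (\<Sum>j \<in> {0..<n} - {i}. x i / (x i - x j))"
proof -
  let ?W = "{w. w permutes {0..<n}}" and ?J = "{0..<n} - {i}"
  define a where "a w = signof w * (\<Prod>k\<in>?J. x k ^ w k)" for w :: "nat \<Rightarrow> nat"
  define P where "P = (\<Sum>w\<in>?W. monom (a w) (w i))"
  have split: "(\<Prod>k = 0..<n. y k ^ w k) = y i ^ w i * (\<Prod>k\<in>?J. y k ^ w k)" for y :: "nat \<Rightarrow> complex" and w
    using i by (intro prod.remove) auto
  have P: "poly P t = alternant n (x(i := t))" for t
    unfolding P_def alternant_def poly_sum poly_monom
    by (intro sum.cong refl) (simp add: split a_def)
  have inj: "inj_on x ?J" using x by (rule inj_on_subset) auto
  have "degree P \<le> n - 1"
    unfolding P_def using i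
  proof (intro degree_sum_le)
    fix w assume "w \<in> ?W"
    then have "w i < n" using i permutes_in_image[of w "{0..<n}" i] by auto
    then show "degree (monom (a w) (w i)) \<le> n - 1"
      by (intro order_trans[OF degree_monom_le]) simp
  qed (simp add: finite_permutations)
  moreover have "poly P s = 0" if "s \<in> x ` ?J" for s
  proof -
    obtain j where "j \<in> ?J" "s = x j" using \<open>s \<in> x ` ?J\<close> by blast
    then show ?thesis unfolding P using i by (intro alternant_eq_0[of j _ i]) auto
  qed
  moreover have "card (x ` ?J) = n - 1" using inj i by (simp add: card_image)
  ultimately obtain c where "P = smult c (\<Prod>s\<in>x ` ?J. [:- s, 1:])"
    using poly_eq_smult_prod_roots[of "x ` ?J" P] by auto
  then have Q: "P = smult c (\<Prod>j\<in>?J. [:- x j, 1:])"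
    by (simp add: prod.reindex[OF inj])
  have nz: "x i - x j \<noteq> 0" if "j \<in> ?J" for j
    using that x i by (auto simp: inj_on_def)
  have "poly (pderiv P) (x i) = c * (\<Sum>j\<in>?J. \<Prod>k\<in>?J - {j}. x i - x k)"
    by (simp add: Q pderiv_smult pderiv_prod pderiv_pCons poly_sum poly_prod)
  also have "\<dots> = c * (\<Sum>j\<in>?J. (\<Prod>k\<in>?J. x i - x k) / (x i - x j))"
  proof -
    have "(\<Prod>k\<in>?J - {j}. x i - x k) = (\<Prod>k\<in>?J. x i - x k) / (x i - x j)" if "j \<in> ?J" for j
      using nz[OF that] prod.remove[of ?J j "\<lambda>k. x i - x k"] that by simp
    then show ?thesis by simp
  qed
  also have "\<dots> = poly P (x i) * (\<Sum>j\<in>?J. 1 / (x i - x j))"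
    by (simp add: Q poly_prod sum_distrib_left)
  finally have "x i * poly (pderiv P) (x i) = alternant n x * (\<Sum>j\<in>?J. x i / (x i - x j))"
    by (simp add: P sum_distrib_left mult_ac)
  moreover have "x i * poly (pderiv P) (x i) =
      (\<Sum>w\<in>?W. signof w * of_nat (w i) * (\<Prod>k = 0..<n. x k ^ w k))"
  proof -
    have pderiv_sum: "pderiv (sum f S) = (\<Sum>s\<in>S. pderiv (f s))" for f :: "'s \<Rightarrow> complex poly" and S
      by (induction S rule: infinite_finite_induct) (simp_all add: pderiv_add)
    have "x i * poly (pderiv P) (x i) = (\<Sum>w\<in>?W. x i * (of_nat (w i) * a w * x i ^ (w i - 1)))"
      by (simp add: P_def pderiv_sum pderiv_monom poly_sum poly_monom sum_distrib_left)
    also have "\<dots> = (\<Sum>w\<in>?W. signof w * of_nat (w i) * (\<Prod>k = 0..<n. x k ^ w k))"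
    proof (intro sum.cong refl)
      fix w
      show "x i * (of_nat (w i) * a w * x i ^ (w i - 1)) = signof w * of_nat (w i) * (\<Prod>k = 0..<n. x k ^ w k)"
        by (cases "w i") (simp_all add: split a_def mult_ac)
    qed
    finally show ?thesis .
  qed
  ultimately show ?thesis by simp
qed


section \<open>Weights and their monomials\<close>

text \<open>
  The weight \<open>\<mu> + \<epsilon>\<^sub>i - \<epsilon>\<^sub>j\<close>, to which the matrix unit \<open>E\<^sub>i\<^sub>j\<close> maps the weight space of \<open>\<mu>\<close>.
\<close>
definition root_shift :: "nat \<Rightarrow> nat \<Rightarrow> (nat \<Rightarrow> int) \<Rightarrow> nat \<Rightarrow> int" where
  "root_shift i j \<mu> = (\<lambda>k. \<mu> k + of_bool (k = i) - of_bool (k = j))"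

lemma sum_root_shift:
  "(\<Sum>a = 0..<k. root_shift i j \<mu> a) = (\<Sum>a = 0..<k. \<mu> a) + of_bool (i < k) - of_bool (j < k)"
proof -
  have "(\<Sum>a = 0..<k. of_bool (a = i) :: int) = of_bool (i < k)" for i :: nat
    by (simp add: of_bool_def)
  then show ?thesis by (simp add: root_shift_def sum.distrib sum_subtractf)
qed

text \<open>
  The dominance order on weights of \<open>gl\<^sub>n\<close>. Weights are functions on all natural numbers; requiring them to
  vanish from \<open>n\<close> on makes equality of weights the same as equality of functions.
\<close>
definition dominated :: "nat \<Rightarrow> (nat \<Rightarrow> int) \<Rightarrow> (nat \<Rightarrow> int) \<Rightarrow> bool" where
  "dominated n \<mu> \<nu> \<longleftrightarrow>
     (\<forall>k\<le>n. (\<Sum>i = 0..<k. \<mu> i) \<le> (\<Sum>i = 0..<k. \<nu> i)) \<and>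
     (\<Sum>i = 0..<n. \<mu> i) = (\<Sum>i = 0..<n. \<nu> i) \<and> (\<forall>i\<ge>n. \<mu> i = 0)"

definition weight_monomial :: "nat \<Rightarrow> (nat \<Rightarrow> complex) \<Rightarrow> (nat \<Rightarrow> int) \<Rightarrow> complex" where
  "weight_monomial n x \<mu> = (\<Prod>k = 0..<n. x k powi \<mu> k)"

lemma weight_monomial_root_shift:
  assumes "\<And>k. k < n \<Longrightarrow> x k \<noteq> 0" "i < n" "j < n" "i \<noteq> j"
  shows "weight_monomial n x (root_shift i j \<mu>) = x i / x j * weight_monomial n x \<mu>"
proof -
  have "weight_monomial n x (root_shift i j \<mu>) =
      (\<Prod>k = 0..<n. x k powi \<mu> k * (if k = i then x k else 1) / (if k = j then x k else 1))"
    unfolding weight_monomial_def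
    using assms by (intro prod.cong) (auto simp: root_shift_def power_int_add power_int_diff)
  also have "\<dots> = weight_monomial n x \<mu> * x i / x j"
    using assms by (simp add: prod.distrib prod_dividef weight_monomial_def)
  finally show ?thesis by simp
qed

lemma base_digits_zero:
  fixes d :: "nat \<Rightarrow> int"
  assumes "\<And>i. i < n \<Longrightarrow> \<bar>d i\<bar> < N" "(\<Sum>i = 0..<n. d i * N ^ i) = 0" "i < n"
  shows "d i = 0"
  using assms
proof (induction n arbitrary: d i)
  case (Suc n)
  have N: "N > 0" using Suc.prems(1)[of 0] by simp
  have "(\<Sum>i = 0..<Suc n. d i * N ^ i) = d 0 + N * (\<Sum>i = 0..<n. d (Suc i) * N ^ i)"
    by (subst sum.atLeast0_lessThan_Suc_shift) (simp add: sum_distrib_left mult_ac)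
  then have eq: "d 0 = N * (- (\<Sum>i = 0..<n. d (Suc i) * N ^ i))"
    using Suc.prems(2) by simp
  then have "N dvd d 0" by (rule dvdI)
  then have d0: "d 0 = 0"
    using dvd_imp_le_int[of "d 0" N] Suc.prems(1)[of 0] N by fastforce
  then have "(\<Sum>i = 0..<n. d (Suc i) * N ^ i) = 0" using eq N by simp
  then have "d (Suc j) = 0" if "j < n" for j
    using Suc.IH[of "\<lambda>i. d (Suc i)" j] Suc.prems(1) that by simp
  then show ?case using d0 Suc.prems(3) by (cases i) auto
qed simp

lemma prod_power_int:
  fixes q :: "'a :: field"
  shows "q \<noteq> 0 \<Longrightarrow> (\<Prod>i\<in>I. q powi f i) = q powi (\<Sum>i\<in>I. f i)"
  by (induction I rule: infinite_finite_induct) (auto simp: power_int_add)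

text \<open>
  Substituting \<open>x\<^sub>k = q^(N^k)\<close> with \<open>N\<close> larger than all differences of exponents makes the weight
  monomials into distinct powers of \<open>q\<close>, and a polynomial in \<open>q\<close> with infinitely many roots is zero. The
  substituted points are distinct and nonzero, which is where the relation is required to hold.
\<close>
lemma weight_monomials_independent:
  fixes a :: "(nat \<Rightarrow> int) \<Rightarrow> complex"
  assumes S: "finite S" "\<And>\<mu> i. \<mu> \<in> S \<Longrightarrow> i \<ge> n \<Longrightarrow> \<mu> i = 0"
    and zero: "\<And>x. (\<forall>k<n. x k \<noteq> 0) \<Longrightarrow> inj_on x {0..<n} \<Longrightarrow> (\<Sum>\<mu>\<in>S. a \<mu> * weight_monomial n x \<mu>) = 0"
    and "\<nu> \<in> S"
  shows "a \<nu> = 0"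
proof -
  define R where "R = Max (insert 0 ((\<lambda>(\<mu>, i). \<bar>\<mu> i\<bar>) ` (S \<times> {0..<n})))"
  have R: "\<bar>\<mu> i\<bar> \<le> R" if "\<mu> \<in> S" "i < n" for \<mu> i
    unfolding R_def using S(1) that by (intro Max_ge) auto
  have "R \<ge> 0" unfolding R_def using S(1) by (intro Max_ge) auto
  \<comment> \<open>Differences of exponents have absolute value at most \<open>2 * R\<close>.\<close>
  define N where "N = nat (2 * R + 2)"
  have N: "N \<ge> 2" "int N = 2 * R + 2" using \<open>R \<ge> 0\<close> by (auto simp: N_def)
  define e where "e \<mu> = (\<Sum>i = 0..<n. \<mu> i * int N ^ i)" for \<mu> :: "nat \<Rightarrow> int"
  have inj: "\<mu> = \<mu>'" if "\<mu> \<in> S" "\<mu>' \<in> S" "e \<mu> = e \<mu>'" for \<mu> \<mu>'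
  proof
    fix i
    show "\<mu> i = \<mu>' i"
    proof (cases "i < n")
      case True
      have "\<mu> i - \<mu>' i = 0"
      proof (rule base_digits_zero[where d = "\<lambda>i. \<mu> i - \<mu>' i" and N = "int N" and n = n])
        show "\<bar>\<mu> k - \<mu>' k\<bar> < int N" if "k < n" for k
          using R[OF \<open>\<mu> \<in> S\<close> that] R[OF \<open>\<mu>' \<in> S\<close> that] N by linarith
        show "(\<Sum>i = 0..<n. (\<mu> i - \<mu>' i) * int N ^ i) = 0"
          using that(3) by (simp add: e_def left_diff_distrib sum_subtractf)
      qed (fact True)
      then show ?thesis by simp
    qed (simp add: S(2) that)
  qed
  define M where "M = Max (insert 0 ((\<lambda>\<mu>. - e \<mu>) ` S))"
  have M: "e \<mu> + M \<ge> 0" if "\<mu> \<in> S" for \<mu>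
  proof -
    have "- e \<mu> \<le> M" unfolding M_def using S(1) that by (intro Max_ge) auto
    then show ?thesis by simp
  qed
  define P where "P = (\<Sum>\<mu>\<in>S. monom (a \<mu>) (nat (e \<mu> + M)))"
  \<comment> \<open>The exponents are shifted by \<open>M\<close>, which makes them natural numbers.\<close>
  have root: "poly P (of_nat q) = 0" if "q \<ge> 2" for q
  proof -
    define x where "x k = (of_nat q :: complex) ^ (N ^ k)" for k
    have "inj_on x {0..<n}"
    proof (rule inj_onI)
      fix k l assume "x k = x l"
      then have "of_nat (q ^ (N ^ k)) = (of_nat (q ^ (N ^ l)) :: complex)" by (simp add: x_def)
      then have "q ^ (N ^ k) = q ^ (N ^ l)" by (simp only: of_nat_eq_iff)
      then have "N ^ k = N ^ l" using \<open>q \<ge> 2\<close> by (subst (asm) power_inject_exp) auto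
      then show "k = l" using N by (subst (asm) power_inject_exp) auto
    qed
    moreover have "\<forall>k<n. x k \<noteq> 0" using \<open>q \<ge> 2\<close> by (simp add: x_def)
    ultimately have 0: "(\<Sum>\<mu>\<in>S. a \<mu> * weight_monomial n x \<mu>) = 0" by (intro zero)
    have mon: "weight_monomial n x \<mu> = of_nat q powi e \<mu>" for \<mu>
    proof -
      have "weight_monomial n x \<mu> = (\<Prod>i = 0..<n. of_nat q powi (\<mu> i * int N ^ i))"
        unfolding weight_monomial_def
      proof (intro prod.cong refl)
        fix k
        have xk: "x k = of_nat q powi (int (N ^ k))" by (simp add: x_def del: of_nat_power)
        have "x k powi \<mu> k = of_nat q powi (int (N ^ k) * \<mu> k)"
          unfolding xk by (rule power_int_mult[symmetric])
        then show "x k powi \<mu> k = of_nat q powi (\<mu> k * int N ^ k)"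
          by (simp only: of_nat_power mult.commute)
      qed
      also have "\<dots> = of_nat q powi e \<mu>"
        unfolding e_def using \<open>q \<ge> 2\<close> by (intro prod_power_int) simp
      finally show ?thesis .
    qed
    have "poly P (of_nat q) = (\<Sum>\<mu>\<in>S. a \<mu> * (of_nat q powi M * of_nat q powi e \<mu>))"
      unfolding P_def poly_sum poly_monom
    proof (intro sum.cong refl)
      fix \<mu> assume "\<mu> \<in> S"
      then have "(of_nat q :: complex) ^ nat (e \<mu> + M) = of_nat q powi (e \<mu> + M)"
        using M by (simp add: power_int_def)
      then show "a \<mu> * of_nat q ^ nat (e \<mu> + M) = a \<mu> * (of_nat q powi M * of_nat q powi e \<mu>)"
        using \<open>q \<ge> 2\<close> by (simp add: power_int_add)
    qed
    also have "\<dots> = of_nat q powi M * (\<Sum>\<mu>\<in>S. a \<mu> * weight_monomial n x \<mu>)"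
      by (simp add: mon sum_distrib_left mult_ac)
    finally show ?thesis using 0 by simp
  qed
  have "P = 0"
  proof (rule ccontr)
    assume "P \<noteq> 0"
    then have "finite {t. poly P t = 0}" by (rule poly_roots_finite)
    then have "finite (of_nat ` {2..} :: complex set)"
      by (rule finite_subset[rotated]) (use root in auto)
    then have "finite {2 :: nat..}" by (rule finite_imageD) (auto simp: inj_on_def)
    then show False by (simp add: infinite_Ici)
  qed
  have "coeff P (nat (e \<nu> + M)) = (\<Sum>\<mu>\<in>S. if \<mu> = \<nu> then a \<mu> else 0)"
    unfolding P_def coeff_sum coeff_monom
  proof (intro sum.cong refl if_cong)
    fix \<mu> assume "\<mu> \<in> S"
    then show "(nat (e \<mu> + M) = nat (e \<nu> + M)) = (\<mu> = \<nu>)"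
      using M[of \<mu>] M[of \<nu>] inj[of \<mu> \<nu>] \<open>\<nu> \<in> S\<close> by auto
  qed
  then show ?thesis using \<open>P = 0\<close> S(1) \<open>\<nu> \<in> S\<close> by simp
qed


section \<open>From the Casimir equation to Weyl's dimension formula\<close>

text \<open>
  The weight \<open>w \<rho>\<close>, cut off at \<open>n\<close>: a permutation of \<open>{0..<n}\<close> is the identity from \<open>n\<close> on, not zero.
\<close>
definition perm_weight :: "nat \<Rightarrow> (nat \<Rightarrow> nat) \<Rightarrow> nat \<Rightarrow> int" where
  "perm_weight n w = (\<lambda>i. if i < n then int (w i) else 0)"

lemma weight_monomial_add:
  assumes "\<And>k. k < n \<Longrightarrow> x k \<noteq> 0"
  shows "weight_monomial n x (\<lambda>i. \<mu> i + \<nu> i) = weight_monomial n x \<mu> * weight_monomial n x \<nu>"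
  unfolding weight_monomial_def prod.distrib[symmetric]
  using assms by (intro prod.cong) (auto simp: power_int_add)

lemma weight_monomial_perm_weight:
  "weight_monomial n x (perm_weight n w) = (\<Prod>k = 0..<n. x k ^ w k)"
  unfolding weight_monomial_def by (intro prod.cong) (auto simp: perm_weight_def)

lemma sum_le_of_card:
  assumes "finite S" "S \<subseteq> {0..<n}" "card S = k"
  shows "(\<Sum>s\<in>S. int s) \<le> (\<Sum>i = 0..<k. int n - 1 - int i)"
  using assms
proof (induction k arbitrary: S)
  case (Suc k)
  then have "S \<noteq> {}" by auto
  define m where "m = Min S"
  have m: "m \<in> S" "\<And>s. s \<in> S \<Longrightarrow> m \<le> s" using Suc.prems \<open>S \<noteq> {}\<close> by (auto simp: m_def)
  have "S \<subseteq> {m..<n}" using m Suc.prems(2) by auto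
  then have "Suc k \<le> n - m" using card_mono[of "{m..<n}" S] Suc.prems(3) by simp
  then have "int m \<le> int n - 1 - int k" by linarith
  moreover have "(\<Sum>s\<in>S - {m}. int s) \<le> (\<Sum>i = 0..<k. int n - 1 - int i)"
    using Suc.prems m by (intro Suc.IH) auto
  moreover have "(\<Sum>s\<in>S. int s) = int m + (\<Sum>s\<in>S - {m}. int s)"
    using m Suc.prems(1) by (intro sum.remove) auto
  ultimately show ?case by simp
qed simp

lemma sum_permutation_le:
  assumes "w permutes {0..<n}" "k \<le> n"
  shows "(\<Sum>i = 0..<k. int (w i)) \<le> (\<Sum>i = 0..<k. int n - 1 - int i)"
proof -
  have inj: "inj_on w {0..<k}" using permutes_inj[OF assms(1)] by (rule inj_on_subset) auto
  have "(\<Sum>i = 0..<k. int (w i)) = (\<Sum>s\<in>w ` {0..<k}. int s)"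
    by (simp add: sum.reindex[OF inj])
  also have "\<dots> \<le> (\<Sum>i = 0..<k. int n - 1 - int i)"
  proof (rule sum_le_of_card)
    show "w ` {0..<k} \<subseteq> {0..<n}"
      using assms(2) permutes_in_image[OF assms(1)] by fastforce
  qed (simp_all add: card_image[OF inj])
  finally show ?thesis .
qed

lemma summation_by_parts:
  fixes a d :: "nat \<Rightarrow> int"
  shows "(\<Sum>i = 0..<Suc m. a i * d i) =
    (\<Sum>k = 0..<m. (a k - a (Suc k)) * (\<Sum>i = 0..<Suc k. d i)) + a m * (\<Sum>i = 0..<Suc m. d i)"
  by (induction m) (simp_all add: algebra_simps)

text \<open>
  This is the usual argument that \<open>(\<lambda> + \<rho> + \<nu>, \<lambda> + \<rho> - \<nu>) = 0\<close> forces \<open>\<nu> = \<lambda> + \<rho>\<close>: after summation by parts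
  the pairing is a sum of nonnegative terms, the partial sums of \<open>d\<close> with positive weights.
\<close>
lemma strict_decreasing_pairing_zero:
  fixes a d :: "nat \<Rightarrow> int"
  assumes a: "\<And>i. Suc i < n \<Longrightarrow> a (Suc i) < a i"
    and partial: "\<And>k. k \<le> n \<Longrightarrow> 0 \<le> (\<Sum>i = 0..<k. d i)" and total: "(\<Sum>i = 0..<n. d i) = 0"
    and zero: "(\<Sum>i = 0..<n. a i * d i) = 0" and "i < n"
  shows "d i = 0"
proof -
  obtain m where m: "n = Suc m" using \<open>i < n\<close> by (cases n) auto
  have "(\<Sum>k = 0..<m. (a k - a (Suc k)) * (\<Sum>i = 0..<Suc k. d i)) = 0"
    using summation_by_parts[of a d m] zero total by (simp add: m)
  moreover have "0 \<le> (a k - a (Suc k)) * (\<Sum>i = 0..<Suc k. d i)" if "k \<in> {0..<m}" for k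
    using a[of k] partial[of "Suc k"] that by (intro mult_nonneg_nonneg) (auto simp: m)
  ultimately have terms: "(a k - a (Suc k)) * (\<Sum>i = 0..<Suc k. d i) = 0" if "k < m" for k
    using sum_nonneg_eq_0_iff[of "{0..<m}" "\<lambda>k. (a k - a (Suc k)) * (\<Sum>i = 0..<Suc k. d i)"] that
    by simp
  have S: "(\<Sum>i = 0..<k. d i) = 0" if "k \<le> n" for k
  proof (cases k)
    case (Suc l)
    show ?thesis
    proof (cases "l < m")
      case True
      then have "a l - a (Suc l) \<noteq> 0" using a[of l] by (simp add: m)
      then show ?thesis using terms[OF True] unfolding Suc mult_eq_0_iff by blast
    next
      case False
      then have "k = n" using Suc that m by simp
      then show ?thesis using total by simp
    qed
  qed simp
  show ?thesis using S[of "Suc i"] S[of i] \<open>i < n\<close> by simp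
qed

lemma ex_sorting_permutation:
  fixes f :: "nat \<Rightarrow> 'a :: linorder"
  shows "\<exists>p. p permutes {0..<n} \<and> (\<forall>i j. i \<le> j \<longrightarrow> j < n \<longrightarrow> f (p j) \<le> f (p i))"
proof -
  let ?ys = "map f [0..<n]" and ?xs = "rev (sort (map f [0..<n]))"
  have "mset ?xs = mset ?ys" by simp
  then obtain p where p: "p permutes {..<length ?ys}" "permute_list p ?ys = ?xs"
    by (rule mset_eq_permutation)
  have pn: "p permutes {0..<n}" using p(1) by (simp add: atLeast0LessThan)
  have nth: "?xs ! i = f (p i)" if "i < n" for i
  proof -
    have "p i < n" using permutes_in_image[OF pn, of i] that by simp
    have "?xs ! i = permute_list p ?ys ! i" using p(2) by simp
    also have "\<dots> = ?ys ! p i" using p(1) that by (intro permute_list_nth) auto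
    finally show ?thesis using \<open>p i < n\<close> by simp
  qed
  have "f (p j) \<le> f (p i)" if "i \<le> j" "j < n" for i j
  proof -
    have sorted: "sorted_wrt (\<ge>) ?xs" and len: "j < length ?xs"
      using \<open>j < n\<close> by (simp_all add: sorted_wrt_rev)
    have "?xs ! j \<le> ?xs ! i" if "i < j"
      by (rule sorted_wrt_nth_less[OF sorted that len])
    then show ?thesis using nth that by (cases "i = j") auto
  qed
  then show ?thesis using pn by blast
qed

text \<open>
  The properties of the weights of a simple module from which its dimension is derived. The set \<open>B\<close>
  stands for a basis of weight vectors and \<open>v\<close> for the highest one. The last assumption is the trace of
  the Casimir operator \<open>\<Sum> E\<^sub>i\<^sub>j E\<^sub>j\<^sub>i\<close> against the weight monomials, written without derivatives: \<open>x\<^sub>i \<partial>/\<partial>x\<^sub>i\<close>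
  multiplies the monomial of weight \<open>\<mu>\<close> by \<open>\<mu>\<^sub>i\<close>.
\<close>
locale radial_character =
  fixes n :: nat and B :: "'b set" and wt :: "'b \<Rightarrow> nat \<Rightarrow> int" and lam :: "nat \<Rightarrow> int"
    and v :: 'b and c :: complex
  assumes finite_B: "finite B"
    and wt_dominated: "b \<in> B \<Longrightarrow> dominated n (wt b) lam"
    and top_weight: "v \<in> B" "b \<in> B \<Longrightarrow> wt b = lam \<longleftrightarrow> b = v"
    and lam_decreasing: "i \<le> j \<Longrightarrow> j < n \<Longrightarrow> lam j \<le> lam i"
    and reflect: "i < n \<Longrightarrow> j < n \<Longrightarrow>
      card {b \<in> B. \<forall>a<n. wt b a = (\<mu> \<circ> transpose i j) a} = card {b \<in> B. \<forall>a<n. wt b a = \<mu> a}"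
    and radial: "(\<And>k. k < n \<Longrightarrow> x k \<noteq> 0) \<Longrightarrow> inj_on x {0..<n} \<Longrightarrow>
      (\<Sum>b\<in>B. (\<Sum>i = 0..<n. (of_int (wt b i))\<^sup>2) * weight_monomial n x (wt b)) +
      (\<Sum>i = 0..<n. \<Sum>j \<in> {0..<n} - {i}.
         x j / (x i - x j) * (\<Sum>b\<in>B. of_int (wt b i - wt b j) * weight_monomial n x (wt b))) =
      c * (\<Sum>b\<in>B. weight_monomial n x (wt b))"
begin

abbreviation "perms \<equiv> {w. w permutes {0..<n}}"

text \<open>
  This is \<open>\<lambda> + \<rho>\<close>, with \<open>\<rho> = (n - 1, ..., 0)\<close>.
\<close>
definition shifted :: "nat \<Rightarrow> int" where
  "shifted i = (if i < n then lam i + (int n - 1 - int i) else 0)"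

definition exponent :: "(nat \<Rightarrow> nat) \<Rightarrow> 'b \<Rightarrow> nat \<Rightarrow> int" where
  "exponent w b = (\<lambda>i. wt b i + perm_weight n w i)"

text \<open>
  The eigenvalue of the flat Laplacian on the product of alternant and character. Its three summands are
  \<open>|\<rho>|\<^sup>2\<close>, the scalar of the Casimir operator, and the contribution of the total degree.
\<close>
definition radial_eigenvalue :: complex where
  "radial_eigenvalue = (\<Sum>i = 0..<n. (of_nat i)\<^sup>2) + c + (of_nat n - 1) * of_int (\<Sum>i = 0..<n. lam i)"

lemma finite_perms: "finite perms"
  by (simp add: finite_permutations)

text \<open>
  Let \<open>D\<close> be the alternant, \<open>P\<close> the sum of the weight monomials, and \<open>\<Delta>\<close> the operator that multiplies a
  monomial by the squared norm of its exponent. In \<open>\<Delta>(D P) = (\<Delta> D) P + 2 \<Sum> (x\<^sub>i \<partial>\<^sub>iD) (x\<^sub>i \<partial>\<^sub>iP) + D (\<Delta> P)\<close> the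
  first term is a multiple of \<open>D P\<close>, and the logarithmic derivative of \<open>D\<close> makes the other two into \<open>D\<close> times
  the left-hand side of the radial equation, up to a multiple of \<open>\<Sum> x\<^sub>i \<partial>\<^sub>iP\<close>, the total degree.
\<close>
lemma alternant_eigenfunction:
  assumes x: "\<And>k. k < n \<Longrightarrow> x k \<noteq> 0" "inj_on x {0..<n}"
  shows "(\<Sum>w\<in>perms. \<Sum>b\<in>B. signof w * ((\<Sum>i = 0..<n. (of_int (exponent w b i))\<^sup>2) - radial_eigenvalue)
    * weight_monomial n x (exponent w b)) = 0"
proof -
  let ?m = "\<lambda>b. weight_monomial n x (wt b)"
  let ?mon = "\<lambda>w. \<Prod>k = 0..<n. x k ^ w k"
  define D where "D = alternant n x"
  define P where "P = (\<Sum>b\<in>B. ?m b)"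
  define P1 where "P1 i = (\<Sum>b\<in>B. of_int (wt b i) * ?m b)" for i
  define P2 where "P2 = (\<Sum>b\<in>B. (\<Sum>i = 0..<n. (of_int (wt b i))\<^sup>2) * ?m b)"
  define D1 where "D1 i = (\<Sum>w\<in>perms. signof w * of_nat (w i) * ?mon w)" for i
  define R where "R = (\<Sum>i = 0..<n. (of_nat i :: complex)\<^sup>2)"
  define q where "q i j = x i / (x i - x j)" for i j
  have mon: "weight_monomial n x (exponent w b) = ?m b * ?mon w" for w b
    unfolding exponent_def using x(1) by (simp add: weight_monomial_add weight_monomial_perm_weight)
  have square: "(\<Sum>i = 0..<n. (of_int (exponent w b i) :: complex)\<^sup>2) =
      (\<Sum>i = 0..<n. (of_int (wt b i))\<^sup>2) + 2 * (\<Sum>i = 0..<n. of_int (wt b i) * of_nat (w i)) + R"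
    if "w \<in> perms" for w b
  proof -
    have "(\<Sum>i = 0..<n. (of_int (exponent w b i) :: complex)\<^sup>2) =
      (\<Sum>i = 0..<n. (of_int (wt b i))\<^sup>2 + 2 * (of_int (wt b i) * of_nat (w i)) + (of_nat (w i))\<^sup>2)"
      by (intro sum.cong) (auto simp: exponent_def perm_weight_def power2_eq_square algebra_simps)
    also have "\<dots> = (\<Sum>i = 0..<n. (of_int (wt b i))\<^sup>2) + 2 * (\<Sum>i = 0..<n. of_int (wt b i) * of_nat (w i))
        + (\<Sum>i = 0..<n. (of_nat (w i))\<^sup>2)"
      by (simp add: sum.distrib sum_distrib_left)
    also have "(\<Sum>i = 0..<n. (of_nat (w i) :: complex)\<^sup>2) = R"
      unfolding R_def using sum.permute[of w "{0..<n}" "\<lambda>i. (of_nat i :: complex)\<^sup>2"] that by (simp add: o_def)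
    finally show ?thesis .
  qed
  \<comment> \<open>The three parts of the square of \<open>wt b i + w i\<close> give \<open>D (\<Delta> P)\<close>, the mixed term and a multiple of \<open>D P\<close>.\<close>
  have part2: "(\<Sum>w\<in>perms. \<Sum>b\<in>B. signof w * (\<Sum>i = 0..<n. (of_int (wt b i))\<^sup>2) * (?m b * ?mon w)) = D * P2"
    unfolding D_def alternant_def P2_def sum_product by (intro sum.cong refl) (simp add: mult_ac)
  have part1: "(\<Sum>w\<in>perms. \<Sum>b\<in>B. signof w * (\<Sum>i = 0..<n. of_int (wt b i) * of_nat (w i)) * (?m b * ?mon w))
      = (\<Sum>i = 0..<n. D1 i * P1 i)"
  proof -
    have "(\<Sum>i = 0..<n. D1 i * P1 i) =
        (\<Sum>i = 0..<n. \<Sum>w\<in>perms. \<Sum>b\<in>B. signof w * (of_int (wt b i) * of_nat (w i)) * (?m b * ?mon w))"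
      unfolding D1_def P1_def sum_product by (intro sum.cong refl) (simp add: mult_ac)
    also have "\<dots> = (\<Sum>w\<in>perms. \<Sum>i = 0..<n. \<Sum>b\<in>B. signof w * (of_int (wt b i) * of_nat (w i)) * (?m b * ?mon w))"
      by (rule sum.swap)
    also have "\<dots> = (\<Sum>w\<in>perms. \<Sum>b\<in>B. \<Sum>i = 0..<n. signof w * (of_int (wt b i) * of_nat (w i)) * (?m b * ?mon w))"
      by (intro sum.cong refl sum.swap)
    finally show ?thesis by (simp add: sum_distrib_left sum_distrib_right mult_ac)
  qed
  have part0: "(\<Sum>w\<in>perms. \<Sum>b\<in>B. signof w * t * (?m b * ?mon w)) = t * (D * P)" for t
    unfolding D_def alternant_def P_def sum_product by (simp add: sum_distrib_left mult_ac)
  have D1: "D1 i = D * (\<Sum>j \<in> {0..<n} - {i}. q i j)" if "i < n" for i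
    unfolding D1_def D_def q_def by (rule alternant_log_derivative[OF x(2) that])
  \<comment> \<open>The Casimir equation, with \<open>x j / (x i - x j) = q i j - 1 = - q j i\<close> used to collect the \<open>P1 i\<close>.\<close>
  have cas: "P2 + 2 * (\<Sum>i = 0..<n. \<Sum>j \<in> {0..<n} - {i}. q i j * P1 i)
      = c * P + (of_nat n - 1) * (\<Sum>i = 0..<n. P1 i)"
  proof -
    have q1: "x j / (x i - x j) = q i j - 1" "q i j - 1 = - q j i" if "i < n" "j \<in> {0..<n} - {i}" for i j
    proof -
      have "x i - x j \<noteq> 0" "x j - x i \<noteq> 0" using x(2) that by (auto simp: inj_on_def)
      then show "x j / (x i - x j) = q i j - 1" "q i j - 1 = - q j i"
        by (simp_all add: q_def divide_simps) (simp_all add: algebra_simps)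
    qed
    have "(\<Sum>i = 0..<n. \<Sum>j \<in> {0..<n} - {i}. x j / (x i - x j) * (\<Sum>b\<in>B. of_int (wt b i - wt b j) * ?m b))
        = (\<Sum>i = 0..<n. \<Sum>j \<in> {0..<n} - {i}. q i j * P1 i - P1 i + q j i * P1 j)"
    proof (intro sum.cong refl)
      fix i j assume ij: "i \<in> {0..<n}" "j \<in> {0..<n} - {i}"
      have "(\<Sum>b\<in>B. of_int (wt b i - wt b j) * ?m b) = P1 i - P1 j"
        by (simp add: P1_def left_diff_distrib sum_subtractf)
      then have "x j / (x i - x j) * (\<Sum>b\<in>B. of_int (wt b i - wt b j) * ?m b) = (q i j - 1) * P1 i - (q i j - 1) * P1 j"
        using q1(1) ij by (simp add: right_diff_distrib)
      also have "(q i j - 1) * P1 j = - q j i * P1 j"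
        using q1(2)[of i j] ij by simp
      finally show "x j / (x i - x j) * (\<Sum>b\<in>B. of_int (wt b i - wt b j) * ?m b)
          = q i j * P1 i - P1 i + q j i * P1 j"
        by (simp add: algebra_simps)
    qed
    also have "\<dots> = (\<Sum>i = 0..<n. \<Sum>j \<in> {0..<n} - {i}. q i j * P1 i)
        - (\<Sum>i = 0..<n. (of_nat n - 1) * P1 i) + (\<Sum>i = 0..<n. \<Sum>j \<in> {0..<n} - {i}. q j i * P1 j)"
      by (simp add: sum.distrib sum_subtractf of_nat_diff)
    also have "(\<Sum>i = 0..<n. \<Sum>j \<in> {0..<n} - {i}. q j i * P1 j) = (\<Sum>j = 0..<n. \<Sum>i \<in> {0..<n} - {j}. q j i * P1 j)"
    proof -
      have "(\<Sum>i = 0..<n. \<Sum>j \<in> {0..<n} - {i}. g i j) = (\<Sum>i = 0..<n. \<Sum>j = 0..<n. if i = j then 0 else g i j)"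
        for g :: "nat \<Rightarrow> nat \<Rightarrow> complex"
        by (intro sum.cong refl sum.mono_neutral_cong_left) auto
      note this[of "\<lambda>i j. q j i * P1 j"] this[of "\<lambda>i j. q i j * P1 i"]
      moreover have "(\<Sum>i = 0..<n. \<Sum>j = 0..<n. if i = j then 0 else q j i * P1 j) =
          (\<Sum>j = 0..<n. \<Sum>i = 0..<n. if j = i then 0 else q j i * P1 j)"
        by (subst sum.swap) (intro sum.cong refl, auto)
      ultimately show ?thesis by simp
    qed
    finally have T: "(\<Sum>i = 0..<n. \<Sum>j \<in> {0..<n} - {i}. x j / (x i - x j) * (\<Sum>b\<in>B. of_int (wt b i - wt b j) * ?m b))
        = 2 * (\<Sum>i = 0..<n. \<Sum>j \<in> {0..<n} - {i}. q i j * P1 i) - (of_nat n - 1) * (\<Sum>i = 0..<n. P1 i)"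
      by (simp add: sum_distrib_left)
    show ?thesis using radial[OF x] unfolding T P2_def[symmetric] P_def[symmetric] by (simp add: algebra_simps)
  qed
  have total: "(\<Sum>i = 0..<n. P1 i) = of_int (\<Sum>i = 0..<n. lam i) * P"
  proof -
    have "(\<Sum>i = 0..<n. P1 i) = (\<Sum>b\<in>B. of_int (\<Sum>i = 0..<n. wt b i) * ?m b)"
      unfolding P1_def by (subst sum.swap) (simp add: sum_distrib_right)
    also have "\<dots> = (\<Sum>b\<in>B. of_int (\<Sum>i = 0..<n. lam i) * ?m b)"
    proof (intro sum.cong refl)
      fix b assume "b \<in> B"
      then have "(\<Sum>i = 0..<n. wt b i) = (\<Sum>i = 0..<n. lam i)"
        using wt_dominated by (simp add: dominated_def)
      then show "of_int (\<Sum>i = 0..<n. wt b i) * ?m b = of_int (\<Sum>i = 0..<n. lam i) * ?m b"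
        by (simp only:)
    qed
    finally show ?thesis by (simp add: P_def sum_distrib_left)
  qed
  have "(\<Sum>w\<in>perms. \<Sum>b\<in>B. signof w * ((\<Sum>i = 0..<n. (of_int (exponent w b i))\<^sup>2) - radial_eigenvalue)
      * weight_monomial n x (exponent w b)) =
    (\<Sum>w\<in>perms. \<Sum>b\<in>B. signof w * (\<Sum>i = 0..<n. (of_int (wt b i))\<^sup>2) * (?m b * ?mon w)
      + 2 * (signof w * (\<Sum>i = 0..<n. of_int (wt b i) * of_nat (w i)) * (?m b * ?mon w))
      + signof w * (R - radial_eigenvalue) * (?m b * ?mon w))"
    by (intro sum.cong refl) (simp add: square mon algebra_simps)
  also have "\<dots> = D * P2 + 2 * (\<Sum>i = 0..<n. D1 i * P1 i) + (R - radial_eigenvalue) * (D * P)"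
    unfolding part2[symmetric] part1[symmetric] part0[symmetric] sum_distrib_left sum.distrib ..
  also have "(\<Sum>i = 0..<n. D1 i * P1 i) = D * (\<Sum>i = 0..<n. \<Sum>j \<in> {0..<n} - {i}. q i j * P1 i)"
    by (simp add: D1 sum_distrib_left sum_distrib_right mult_ac)
  also have "D * P2 + 2 * (D * (\<Sum>i = 0..<n. \<Sum>j \<in> {0..<n} - {i}. q i j * P1 i)) + (R - radial_eigenvalue) * (D * P)
      = D * (P2 + 2 * (\<Sum>i = 0..<n. \<Sum>j \<in> {0..<n} - {i}. q i j * P1 i)) + (R - radial_eigenvalue) * (D * P)"
    by (simp add: algebra_simps)
  also have "\<dots> = 0"
    unfolding cas total radial_eigenvalue_def R_def by (simp add: algebra_simps)
  finally show ?thesis .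
qed


text \<open>
  The coefficient of the monomial with exponent \<open>\<mu>\<close> in the product of alternant and character.
\<close>
definition coef :: "(nat \<Rightarrow> int) \<Rightarrow> complex" where
  "coef \<mu> = (\<Sum>w\<in>perms. \<Sum>b\<in>B. if exponent w b = \<mu> then signof w else 0)"

definition exponents :: "(nat \<Rightarrow> int) set" where
  "exponents = (\<lambda>(w, b). exponent w b) ` (perms \<times> B)"

lemma finite_exponents: "finite exponents"
  unfolding exponents_def using finite_perms finite_B by simp

lemma exponent_outside: "b \<in> B \<Longrightarrow> i \<ge> n \<Longrightarrow> exponent w b i = 0"
  using wt_dominated by (auto simp: exponent_def perm_weight_def dominated_def)

lemma coef_support: "coef \<mu> \<noteq> 0 \<Longrightarrow> \<exists>w\<in>perms. \<exists>b\<in>B. exponent w b = \<mu>"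
  by (rule ccontr) (simp add: coef_def)

lemma sum_over_exponents:
  "(\<Sum>w\<in>perms. \<Sum>b\<in>B. signof w * f (exponent w b)) = (\<Sum>\<mu>\<in>exponents. coef \<mu> * f \<mu>)"
proof -
  have "(\<Sum>\<mu>\<in>exponents. coef \<mu> * f \<mu>) =
      (\<Sum>\<mu>\<in>exponents. \<Sum>w\<in>perms. \<Sum>b\<in>B. if exponent w b = \<mu> then signof w * f \<mu> else 0)"
    unfolding coef_def sum_distrib_right by (intro sum.cong refl) auto
  also have "\<dots> = (\<Sum>w\<in>perms. \<Sum>\<mu>\<in>exponents. \<Sum>b\<in>B. if exponent w b = \<mu> then signof w * f \<mu> else 0)"
    by (rule sum.swap)
  also have "\<dots> = (\<Sum>w\<in>perms. \<Sum>b\<in>B. \<Sum>\<mu>\<in>exponents. if exponent w b = \<mu> then signof w * f \<mu> else 0)"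
    by (intro sum.cong refl sum.swap)
  also have "\<dots> = (\<Sum>w\<in>perms. \<Sum>b\<in>B. signof w * f (exponent w b))"
  proof (intro sum.cong refl)
    fix w b assume "w \<in> perms" "b \<in> B"
    then have "exponent w b \<in> exponents" unfolding exponents_def by force
    then show "(\<Sum>\<mu>\<in>exponents. if exponent w b = \<mu> then signof w * f \<mu> else 0) = signof w * f (exponent w b)"
      using finite_exponents by simp
  qed
  finally show ?thesis by simp
qed

text \<open>
  The identity \<open>alternant_eigenfunction\<close> is a vanishing combination of monomials, so every coefficient in it
  is zero.
\<close>
lemma coef_eigen:
  assumes "coef \<mu> \<noteq> 0"
  shows "of_int (\<Sum>i = 0..<n. (\<mu> i)\<^sup>2) = radial_eigenvalue"
proof -
  let ?a = "\<lambda>\<mu>. coef \<mu> * ((\<Sum>i = 0..<n. (of_int (\<mu> i))\<^sup>2) - radial_eigenvalue)"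
  have "\<mu> \<in> exponents" using coef_support[OF assms] unfolding exponents_def by force
  have "?a \<mu> = 0"
  proof (rule weight_monomials_independent[OF finite_exponents _ _ \<open>\<mu> \<in> exponents\<close>, where n = n])
    show "\<nu> i = 0" if "\<nu> \<in> exponents" "n \<le> i" for \<nu> i
      using that exponent_outside unfolding exponents_def by auto
    fix x :: "nat \<Rightarrow> complex" assume x: "\<forall>k<n. x k \<noteq> 0" "inj_on x {0..<n}"
    have "(\<Sum>\<mu>\<in>exponents. coef \<mu> * (((\<Sum>i = 0..<n. (of_int (\<mu> i))\<^sup>2) - radial_eigenvalue) * weight_monomial n x \<mu>)) = 0"
      unfolding sum_over_exponents[symmetric]
      using alternant_eigenfunction[of x] x by (simp add: mult.assoc)
    then show "(\<Sum>\<mu>\<in>exponents. ?a \<mu> * weight_monomial n x \<mu>) = 0"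
      by (simp add: mult.assoc)
  qed
  then show ?thesis using assms by simp
qed

lemma multiplicity_permute:
  assumes "p permutes {0..<n}"
  shows "card {b \<in> B. \<forall>a<n. wt b a = (\<mu> \<circ> p) a} = card {b \<in> B. \<forall>a<n. wt b a = \<mu> a}"
  using assms finite_atLeastLessThan[of 0 n]
proof (induction arbitrary: \<mu> rule: permutes_induct)
  case id
  show ?case by simp
next
  case (swap a b p)
  have "card {c \<in> B. \<forall>i<n. wt c i = (\<mu> \<circ> (transpose a b \<circ> p)) i} =
      card {c \<in> B. \<forall>i<n. wt c i = (\<mu> \<circ> transpose a b) i}"
    using swap.IH[of "\<mu> \<circ> transpose a b"] by (simp only: comp_assoc)
  also have "\<dots> = card {c \<in> B. \<forall>i<n. wt c i = \<mu> i}"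
    using swap by (intro reflect) auto
  finally show ?case .
qed

lemma coef_eq_multiplicities:
  assumes "\<And>i. i \<ge> n \<Longrightarrow> \<mu> i = 0"
  shows "coef \<mu> = (\<Sum>w\<in>perms. signof w * of_nat (card {b \<in> B. \<forall>a<n. wt b a = \<mu> a - int (w a)}))"
  unfolding coef_def
proof (intro sum.cong refl)
  fix w
  have "exponent w b = \<mu> \<longleftrightarrow> (\<forall>a<n. wt b a = \<mu> a - int (w a))" if "b \<in> B" for b
  proof
    assume "exponent w b = \<mu>"
    then show "\<forall>a<n. wt b a = \<mu> a - int (w a)" by (auto simp: exponent_def perm_weight_def)
  next
    assume *: "\<forall>a<n. wt b a = \<mu> a - int (w a)"
    show "exponent w b = \<mu>"
    proof
      fix a show "exponent w b a = \<mu> a"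
        using * exponent_outside[OF that, of a w] assms[of a]
        by (cases "a < n") (auto simp: exponent_def perm_weight_def)
    qed
  qed
  then have "(\<Sum>b\<in>B. if exponent w b = \<mu> then signof w else 0) =
      (\<Sum>b\<in>B. if \<forall>a<n. wt b a = \<mu> a - int (w a) then signof w else (0 :: complex))"
    by (intro sum.cong refl if_cong) auto
  also have "\<dots> = (\<Sum>b\<in>{b \<in> B. \<forall>a<n. wt b a = \<mu> a - int (w a)}. signof w)"
    using finite_B by (subst sum.inter_filter[symmetric]) auto
  finally show "(\<Sum>b\<in>B. if exponent w b = \<mu> then signof w else 0) =
      (signof w * of_nat (card {b \<in> B. \<forall>a<n. wt b a = \<mu> a - int (w a)}) :: complex)"
    by simp
qed

text \<open>
  The alternant is antisymmetric and the character is symmetric.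
\<close>
lemma coef_antisymmetric:
  assumes p: "p permutes {0..<n}" and \<mu>: "\<And>i. i \<ge> n \<Longrightarrow> \<mu> i = 0"
  shows "coef (\<mu> \<circ> p) = signof p * coef \<mu>"
proof -
  have \<mu>p: "(\<mu> \<circ> p) i = 0" if "i \<ge> n" for i
    using \<mu>[of i] that permutes_not_in[OF p, of i] by simp
  have "coef (\<mu> \<circ> p) = (\<Sum>w\<in>perms. signof w *
      of_nat (card {b \<in> B. \<forall>a<n. wt b a = (\<mu> \<circ> p) a - int (w a)}))"
    by (rule coef_eq_multiplicities) (rule \<mu>p)
  also have "\<dots> = (\<Sum>w\<in>perms. signof (w \<circ> p) *
      of_nat (card {b \<in> B. \<forall>a<n. wt b a = (\<mu> \<circ> p) a - int ((w \<circ> p) a)}))"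
    by (rule sum_permutations_compose_right[OF p, where f = "\<lambda>w. signof w *
      of_nat (card {b \<in> B. \<forall>a<n. wt b a = (\<mu> \<circ> p) a - int (w a)})"])
  also have "\<dots> = (\<Sum>w\<in>perms. signof p * (signof w *
      of_nat (card {b \<in> B. \<forall>a<n. wt b a = \<mu> a - int (w a)})))"
  proof (intro sum.cong refl)
    fix w assume "w \<in> perms"
    then have sgn: "sign (w \<circ> p) = sign w * sign p"
      using p by (intro sign_compose) (auto intro: permutes_imp_permutation[of "{0..<n}"])
    have "card {b \<in> B. \<forall>a<n. wt b a = (\<mu> \<circ> p) a - int ((w \<circ> p) a)} =
        card {b \<in> B. \<forall>a<n. wt b a = \<mu> a - int (w a)}"
      using multiplicity_permute[OF p, of "\<lambda>a. \<mu> a - int (w a)"] by (simp add: comp_def)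
    then show "signof (w \<circ> p) * of_nat (card {b \<in> B. \<forall>a<n. wt b a = (\<mu> \<circ> p) a - int ((w \<circ> p) a)}) =
        (signof p * (signof w * of_nat (card {b \<in> B. \<forall>a<n. wt b a = \<mu> a - int (w a)})) :: complex)"
      by (simp only: sgn of_int_mult mult_ac)
  qed
  also have "\<dots> = signof p * (\<Sum>w\<in>perms. signof w *
      of_nat (card {b \<in> B. \<forall>a<n. wt b a = \<mu> a - int (w a)}))"
    by (rule sum_distrib_left[symmetric])
  also have "\<dots> = signof p * coef \<mu>"
    by (rule arg_cong[OF coef_eq_multiplicities[symmetric]]) (rule \<mu>)
  finally show ?thesis .
qed

lemma shifted_strict_decreasing: "i < j \<Longrightarrow> j < n \<Longrightarrow> shifted j < shifted i"
  using lam_decreasing[of i j] by (simp add: shifted_def)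

lemma shifted_outside: "i \<ge> n \<Longrightarrow> shifted i = 0"
  by (simp add: shifted_def)

lemma sum_shifted: "k \<le> n \<Longrightarrow> (\<Sum>i = 0..<k. shifted i) = (\<Sum>i = 0..<k. lam i) + (\<Sum>i = 0..<k. int n - 1 - int i)"
  unfolding sum.distrib[symmetric] by (intro sum.cong) (auto simp: shifted_def)

lemma sum_perm_weight: "k \<le> n \<Longrightarrow> (\<Sum>i = 0..<k. perm_weight n w i) = (\<Sum>i = 0..<k. int (w i))"
  by (intro sum.cong) (auto simp: perm_weight_def)

lemma exponent_partial_sums:
  assumes "w \<in> perms" "b \<in> B" "k \<le> n"
  shows "(\<Sum>i = 0..<k. exponent w b i) \<le> (\<Sum>i = 0..<k. shifted i)"
proof -
  have "(\<Sum>i = 0..<k. wt b i) \<le> (\<Sum>i = 0..<k. lam i)"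
    using wt_dominated[OF assms(2)] assms(3) by (simp add: dominated_def)
  then show ?thesis
    using sum_permutation_le[of w n k] assms
    by (simp add: exponent_def sum.distrib sum_perm_weight sum_shifted)
qed

lemma exponent_total:
  assumes "w \<in> perms" "b \<in> B"
  shows "(\<Sum>i = 0..<n. exponent w b i) = (\<Sum>i = 0..<n. shifted i)"
proof -
  have "(\<Sum>i = 0..<n. int (w i)) = (\<Sum>i = 0..<n. int i)"
    using sum.permute[of w "{0..<n}" int] assms(1) by (simp add: o_def)
  also have "\<dots> = (\<Sum>i = 0..<n. int (n - Suc i))"
    by (rule sum.nat_diff_reindex[of int, unfolded lessThan_atLeast0, symmetric])
  also have "\<dots> = (\<Sum>i = 0..<n. int n - 1 - int i)"
    by (intro sum.cong) auto
  finally show ?thesis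
    using wt_dominated[OF assms(2)]
    by (simp add: exponent_def sum.distrib sum_perm_weight sum_shifted dominated_def)
qed

definition revperm :: "nat \<Rightarrow> nat" where
  "revperm i = (if i < n then n - Suc i else i)"

lemma revperm_permutes: "revperm permutes {0..<n}"
proof (rule bij_imp_permutes)
  show "bij_betw revperm {0..<n} {0..<n}"
    by (rule bij_betw_byWitness[where f' = revperm]) (auto simp: revperm_def)
qed (auto simp: revperm_def)

text \<open>
  An exponent \<open>\<mu> + w \<rho>\<close> is dominated by \<open>\<lambda> + \<rho>\<close>, and equality forces equality for both summands: the partial sums
  of \<open>w\<close> must all be maximal, which determines \<open>w\<close> value by value.
\<close>
lemma exponent_eq_shifted:
  assumes "w \<in> perms" "b \<in> B" "exponent w b = shifted"
  shows "w = revperm" "b = v"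
proof -
  have eq: "wt b i + int (w i) = lam i + (int n - 1 - int i)" if "i < n" for i
    using fun_cong[OF assms(3), of i] that by (simp add: exponent_def perm_weight_def shifted_def)
  have le: "(\<Sum>i = 0..<k. int n - 1 - int i) \<le> (\<Sum>i = 0..<k. int (w i))" if "k \<le> n" for k
  proof -
    have "(\<Sum>i = 0..<k. wt b i) + (\<Sum>i = 0..<k. int (w i)) = (\<Sum>i = 0..<k. lam i) + (\<Sum>i = 0..<k. int n - 1 - int i)"
      unfolding sum.distrib[symmetric] using eq that by (intro sum.cong) auto
    moreover have "(\<Sum>i = 0..<k. wt b i) \<le> (\<Sum>i = 0..<k. lam i)"
      using wt_dominated[OF assms(2)] that by (simp add: dominated_def)
    ultimately show ?thesis by linarith
  qed
  have w: "w permutes {0..<n}" using assms(1) by simp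
  have weq: "w i = n - Suc i" if "i < n" for i
    using that
  proof (induction i rule: less_induct)
    case (less i)
    have "(\<Sum>k = 0..<i. int (w k)) = (\<Sum>k = 0..<i. int n - 1 - int k)"
      using less by (intro sum.cong) auto
    then have ge: "int n - 1 - int i \<le> int (w i)" using le[of "Suc i"] less.prems by simp
    have "w i < n" using permutes_in_image[OF w, of i] less.prems by simp
    show ?case
    proof (rule ccontr)
      assume "w i \<noteq> n - Suc i"
      then have lt: "n - Suc (w i) < i" using ge less.prems \<open>w i < n\<close> by linarith
      then have "w (n - Suc (w i)) = n - Suc (n - Suc (w i))"
        using less.IH[OF lt] less.prems by simp
      also have "\<dots> = w i" using \<open>w i < n\<close> by simp
      finally have "n - Suc (w i) = i" using permutes_inj[OF w] by (simp add: inj_eq)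
      then show False using lt by simp
    qed
  qed
  show "w = revperm"
  proof
    fix i show "w i = revperm i"
      using weq permutes_not_in[OF w, of i] by (cases "i < n") (auto simp: revperm_def)
  qed
  have "wt b i = lam i" for i
  proof (cases "i < n")
    case True
    then show ?thesis using eq[OF True] weq[OF True] by simp
  next
    case False
    then show ?thesis
      using wt_dominated[OF assms(2)] wt_dominated[OF top_weight(1)] top_weight(2)[OF top_weight(1)]
      by (simp add: dominated_def)
  qed
  then show "b = v" using top_weight(2)[OF assms(2)] by auto
qed

lemma coef_shifted: "coef shifted = signof revperm"
proof -
  have lam: "wt v = lam" using top_weight by simp
  have v: "exponent revperm v = shifted"
  proof
    fix i
    show "exponent revperm v i = shifted i"
      using exponent_outside[OF top_weight(1), of i revperm]
      by (cases "i < n") (auto simp: exponent_def perm_weight_def shifted_def revperm_def lam)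
  qed
  have "coef shifted = (\<Sum>w\<in>perms. \<Sum>b\<in>B. if w = revperm \<and> b = v then signof w else 0)"
    unfolding coef_def using exponent_eq_shifted v by (intro sum.cong refl if_cong) blast+
  also have "\<dots> = (\<Sum>w\<in>perms. if w = revperm then signof w else 0)"
    using top_weight(1) finite_B by (intro sum.cong refl) simp
  also have "\<dots> = signof revperm"
    using finite_perms revperm_permutes by simp
  finally show ?thesis .
qed

text \<open>
  By antisymmetry the exponent may be sorted. It then is weakly decreasing, dominated by \<open>\<lambda> + \<rho>\<close>, and of the
  same norm as \<open>\<lambda> + \<rho>\<close>, so it equals \<open>\<lambda> + \<rho>\<close>.
\<close>
lemma coef_nonzero_imp_permuted:
  assumes "coef \<mu> \<noteq> 0"
  shows "\<exists>p\<in>perms. \<mu> = shifted \<circ> p"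
proof -
  have \<mu>: "\<mu> i = 0" if "i \<ge> n" for i
    using coef_support[OF assms] exponent_outside that by metis
  obtain p where p: "p permutes {0..<n}" "\<And>i j. i \<le> j \<Longrightarrow> j < n \<Longrightarrow> \<mu> (p j) \<le> \<mu> (p i)"
    using ex_sorting_permutation[of n \<mu>] by blast
  define \<nu> where "\<nu> = \<mu> \<circ> p"
  have \<nu>0: "\<nu> i = 0" if "i \<ge> n" for i
    using \<mu>[of i] permutes_not_in[OF p(1), of i] that by (simp add: \<nu>_def)
  have "coef \<nu> \<noteq> 0"
    using assms coef_antisymmetric[OF p(1) \<mu>] by (simp add: \<nu>_def)
  then obtain w b where wb: "w \<in> perms" "b \<in> B" "exponent w b = \<nu>" using coef_support by blast
  have "coef shifted \<noteq> 0" by (simp add: coef_shifted)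
  then have norm: "(\<Sum>i = 0..<n. (\<nu> i)\<^sup>2) = (\<Sum>i = 0..<n. (shifted i)\<^sup>2)"
    using coef_eigen[OF \<open>coef \<nu> \<noteq> 0\<close>] coef_eigen[of shifted] by (metis of_int_eq_iff)
  have "shifted i - \<nu> i = 0" if "i < n" for i
  proof (rule strict_decreasing_pairing_zero[where a = "\<lambda>i. shifted i + \<nu> i" and n = n and d = "\<lambda>i. shifted i - \<nu> i"])
    show "shifted (Suc i) + \<nu> (Suc i) < shifted i + \<nu> i" if "Suc i < n" for i
      using shifted_strict_decreasing[of i "Suc i"] p(2)[of i "Suc i"] that by (simp add: \<nu>_def)
    show "0 \<le> (\<Sum>i = 0..<k. shifted i - \<nu> i)" if "k \<le> n" for k
      using exponent_partial_sums[OF wb(1,2) that] wb(3) by (simp add: sum_subtractf)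
    show "(\<Sum>i = 0..<n. shifted i - \<nu> i) = 0"
      using exponent_total[OF wb(1,2)] wb(3) by (simp add: sum_subtractf)
    show "(\<Sum>i = 0..<n. (shifted i + \<nu> i) * (shifted i - \<nu> i)) = 0"
      using norm by (simp add: algebra_simps power2_eq_square sum_subtractf sum.distrib)
  qed (fact that)
  then have "\<nu> = shifted" using \<nu>0 shifted_outside by (auto simp: fun_eq_iff) (metis not_less)
  have "\<mu> = \<nu> \<circ> inv_into UNIV p" unfolding \<nu>_def comp_assoc using permutes_inv_o(1)[OF p(1)] by simp
  then show ?thesis using \<open>\<nu> = shifted\<close> permutes_inv[OF p(1)] by auto
qed

lemma shifted_inj: "inj_on shifted {0..<n}"
  by (rule linorder_inj_onI) (use shifted_strict_decreasing in force)+

text \<open>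
  Weyl's character formula; the sign is due to the increasing order of the exponents in the alternant.
\<close>
lemma character_formula:
  assumes x: "\<And>k. k < n \<Longrightarrow> x k \<noteq> 0"
  shows "alternant n x * (\<Sum>b\<in>B. weight_monomial n x (wt b)) =
    signof revperm * (\<Sum>p\<in>perms. signof p * weight_monomial n x (shifted \<circ> p))"
proof -
  have "alternant n x * (\<Sum>b\<in>B. weight_monomial n x (wt b)) =
      (\<Sum>w\<in>perms. \<Sum>b\<in>B. signof w * weight_monomial n x (exponent w b))"
    unfolding alternant_def sum_product exponent_def
    using x by (intro sum.cong refl) (simp add: weight_monomial_add weight_monomial_perm_weight)
  also have "\<dots> = (\<Sum>\<mu>\<in>exponents. coef \<mu> * weight_monomial n x \<mu>)"
    by (rule sum_over_exponents)
  also have "\<dots> = (\<Sum>\<mu>\<in>exponents \<union> (\<lambda>p. shifted \<circ> p) ` perms. coef \<mu> * weight_monomial n x \<mu>)"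
  proof (intro sum.mono_neutral_left ballI)
    fix \<mu> assume "\<mu> \<in> exponents \<union> (\<lambda>p. shifted \<circ> p) ` perms - exponents"
    then have "coef \<mu> = 0" using coef_support[of \<mu>] by (force simp: exponents_def)
    then show "coef \<mu> * weight_monomial n x \<mu> = 0" by simp
  qed (use finite_exponents finite_perms in auto)
  also have "\<dots> = (\<Sum>\<mu>\<in>(\<lambda>p. shifted \<circ> p) ` perms. coef \<mu> * weight_monomial n x \<mu>)"
  proof (intro sum.mono_neutral_right ballI)
    fix \<mu> assume "\<mu> \<in> exponents \<union> (\<lambda>p. shifted \<circ> p) ` perms - (\<lambda>p. shifted \<circ> p) ` perms"
    then have "coef \<mu> = 0" using coef_nonzero_imp_permuted[of \<mu>] by blast
    then show "coef \<mu> * weight_monomial n x \<mu> = 0" by simp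
  qed (use finite_exponents finite_perms in auto)
  also have "\<dots> = (\<Sum>p\<in>perms. coef (shifted \<circ> p) * weight_monomial n x (shifted \<circ> p))"
  proof (subst sum.reindex)
    show "inj_on (\<lambda>p. shifted \<circ> p) perms"
    proof (rule inj_onI)
      fix p p' assume p: "p \<in> perms" "p' \<in> perms" "shifted \<circ> p = shifted \<circ> p'"
      show "p = p'"
      proof
        fix i show "p i = p' i"
        proof (cases "i < n")
          case True
          then have "p i \<in> {0..<n}" "p' i \<in> {0..<n}"
            using p permutes_in_image[of p "{0..<n}" i] permutes_in_image[of p' "{0..<n}" i] by auto
          moreover have "shifted (p i) = shifted (p' i)" using fun_cong[OF p(3), of i] by simp
          ultimately show ?thesis using shifted_inj by (auto dest: inj_onD)
        qed (use p in \<open>auto simp: permutes_def\<close>)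
      qed
    qed
  qed simp
  also have "\<dots> = (\<Sum>p\<in>perms. signof p * signof revperm * weight_monomial n x (shifted \<circ> p))"
    by (intro sum.cong refl) (simp add: coef_antisymmetric shifted_outside coef_shifted)
  also have "\<dots> = signof revperm * (\<Sum>p\<in>perms. signof p * weight_monomial n x (shifted \<circ> p))"
    by (simp add: sum_distrib_left mult_ac)
  finally show ?thesis .
qed


text \<open>
  At the point \<open>x\<^sub>i = q\<^sup>i\<close> the roles of exponents and variables can be exchanged, and the numerator of the
  character formula becomes an alternant again.
\<close>
lemma alternating_monomials_at_powers:
  assumes "q \<noteq> 0"
  shows "(\<Sum>p\<in>perms. signof p * weight_monomial n (\<lambda>i. q ^ i) (shifted \<circ> p)) =
    alternant n (\<lambda>k. q powi shifted k)"
proof -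
  have "(\<Sum>p\<in>perms. signof p * weight_monomial n (\<lambda>i. q ^ i) (shifted \<circ> p)) =
      (\<Sum>p\<in>perms. signof (inv_into UNIV p) * weight_monomial n (\<lambda>i. q ^ i) (shifted \<circ> inv_into UNIV p))"
    by (rule sum_permutations_inverse)
  also have "\<dots> = (\<Sum>p\<in>perms. signof p * (\<Prod>k = 0..<n. (q powi shifted k) ^ p k))"
  proof (intro sum.cong refl)
    fix p assume "p \<in> perms"
    then have p: "p permutes {0..<n}" by simp
    have "weight_monomial n (\<lambda>i. q ^ i) (shifted \<circ> inv_into UNIV p) =
        (\<Prod>i = 0..<n. (q ^ p i) powi (shifted (inv_into UNIV p (p i))))"
      unfolding weight_monomial_def
      using prod.permute[OF p, of "\<lambda>i. (q ^ i) powi (shifted \<circ> inv_into UNIV p) i"] by (simp add: comp_def)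
    also have "\<dots> = (\<Prod>k = 0..<n. (q powi shifted k) ^ p k)"
    proof (intro prod.cong refl)
      fix k
      have "(q ^ p k) powi shifted k = (q powi int (p k)) powi shifted k" by simp
      also have "\<dots> = q powi (shifted k * int (p k))"
        unfolding power_int_mult[symmetric] by (simp only: mult.commute)
      also have "\<dots> = (q powi shifted k) ^ p k"
        by (simp add: power_int_mult)
      finally show "(q ^ p k) powi shifted (inv_into UNIV p (p k)) = (q powi shifted k) ^ p k"
        by (simp add: permutes_inverses(2)[OF p])
    qed
    finally show "signof (inv_into UNIV p) * weight_monomial n (\<lambda>i. q ^ i) (shifted \<circ> inv_into UNIV p) =
        signof p * (\<Prod>k = 0..<n. (q powi shifted k) ^ p k)"
      using sign_inverse[OF permutes_imp_permutation[OF _ p]] by simp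
  qed
  finally show ?thesis by (simp add: alternant_def)
qed

lemma q_dimension:
  fixes r :: real
  assumes "r > 1"
  shows "(\<Prod>j = 0..<n. \<Prod>i = 0..<j. of_real r ^ j - of_real r ^ i) *
      (\<Sum>b\<in>B. weight_monomial n (\<lambda>i. of_real r ^ i) (wt b)) =
    (signof revperm * (\<Prod>j = 0..<n. \<Prod>i = 0..<j. of_real r powi shifted j - of_real r powi shifted i) :: complex)"
proof -
  define q where "q = complex_of_real r"
  have q: "q \<noteq> 0" using assms by (simp add: q_def)
  have "inj_on (\<lambda>i. q ^ i) {0..<n}"
  proof (rule inj_onI)
    fix i j assume "q ^ i = q ^ j"
    then have "r ^ i = r ^ j" unfolding q_def by (simp only: of_real_power[symmetric] of_real_eq_iff)
    then show "i = j" using assms by (subst (asm) power_inject_exp)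
  qed
  then have 1: "alternant n (\<lambda>i. q ^ i) = (\<Prod>j = 0..<n. \<Prod>i = 0..<j. q ^ j - q ^ i)"
    by (rule alternant_Vandermonde)
  have "inj_on (\<lambda>k. q powi shifted k) {0..<n}"
  proof (rule inj_onI)
    fix i j assume ij: "i \<in> {0..<n}" "j \<in> {0..<n}" "q powi shifted i = q powi shifted j"
    then have "r powi shifted i = r powi shifted j"
      unfolding q_def by (simp only: of_real_power_int[symmetric] of_real_eq_iff)
    then have "shifted i = shifted j"
      using power_int_strict_increasing[OF _ assms, of "shifted i" "shifted j"]
        power_int_strict_increasing[OF _ assms, of "shifted j" "shifted i"] by linarith
    then show "i = j" using shifted_inj ij by (auto dest: inj_onD)
  qed
  then have 2: "alternant n (\<lambda>k. q powi shifted k) = (\<Prod>j = 0..<n. \<Prod>i = 0..<j. q powi shifted j - q powi shifted i)"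
    by (rule alternant_Vandermonde)
  have "alternant n (\<lambda>i. q ^ i) * (\<Sum>b\<in>B. weight_monomial n (\<lambda>i. q ^ i) (wt b)) =
      signof revperm * alternant n (\<lambda>k. q powi shifted k)"
    using q by (subst character_formula) (simp_all add: alternating_monomials_at_powers)
  then show ?thesis unfolding 1 2 by (simp add: q_def)
qed

lemma power_int_difference_quotient:
  fixes a b :: int
  shows "((\<lambda>r. (of_real r powi a - of_real r powi b) / (of_real r - 1)) \<longlongrightarrow> (of_int (a - b) :: complex))
    (at_right 1)"
proof -
  have "((\<lambda>z :: complex. z powi a - z powi b) has_field_derivative (of_int a - of_int b)) (at 1)"
    by (auto intro!: derivative_eq_intros)
  then have "((\<lambda>z :: complex. (z powi a - z powi b) / (z - 1)) \<longlongrightarrow> of_int (a - b)) (at 1)"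
    by (simp add: has_field_derivative_iff)
  moreover have "filterlim complex_of_real (at 1) (at_right 1)"
  proof (rule filterlim_atI)
    show "(complex_of_real \<longlongrightarrow> 1) (at_right 1)"
      by (rule tendsto_eq_intros | simp)+
    show "\<forall>\<^sub>F r in at_right 1. complex_of_real r \<noteq> 1"
      by (auto simp: eventually_at_right_field intro!: exI[of _ 2])
  qed
  ultimately show ?thesis by (rule filterlim_compose)
qed

text \<open>
  Both sides of \<open>q_dimension\<close> contain one factor for each pair \<open>i < j\<close>. Dividing each factor by
  \<open>r - 1\<close> and letting \<open>r\<close> tend to \<open>1\<close> gives the formula up to sign; both sides are nonnegative.
\<close>
lemma weyl_dimension:
  "(\<Prod>j = 0..<n. \<Prod>i = 0..<j. int j - int i) * int (card B) =
   (\<Prod>j = 0..<n. \<Prod>i = 0..<j. shifted i - shifted j)"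
proof -
  let ?F = "\<lambda>f r. \<Prod>j = 0..<n. \<Prod>i = 0..<j. (complex_of_real r powi f j - of_real r powi f i) / (of_real r - 1)"
  let ?X = "\<lambda>r. \<Sum>b\<in>B. weight_monomial n (\<lambda>i. complex_of_real r ^ i) (wt b)"
  have lim: "((?F f) \<longlongrightarrow> of_int (\<Prod>j = 0..<n. \<Prod>i = 0..<j. f j - f i)) (at_right 1)" for f :: "nat \<Rightarrow> int"
    unfolding of_int_prod by (intro tendsto_prod power_int_difference_quotient)
  have "(?X \<longlongrightarrow> (\<Sum>b\<in>B. \<Prod>i = 0..<n. (complex_of_real 1 ^ i) powi wt b i)) (at_right 1)"
    unfolding weight_monomial_def by (intro tendsto_intros) auto
  then have X: "(?X \<longlongrightarrow> of_nat (card B)) (at_right 1)" by simp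
  have ev: "\<forall>\<^sub>F r in at_right 1. ?F int r * ?X r = signof revperm * ?F shifted r"
  proof (rule eventually_mono[OF eventually_at_right_less])
    fix r :: real assume r: "1 < r"
    define e where "e = (\<Prod>j = 0..<n. \<Prod>i = 0..<j. of_real r - (1 :: complex))"
    have F: "?F f r = (\<Prod>j = 0..<n. \<Prod>i = 0..<j. complex_of_real r powi f j - of_real r powi f i) / e" for f
      by (simp only: prod_dividef e_def)
    show "?F int r * ?X r = signof revperm * ?F shifted r"
      unfolding F using q_dimension[OF r] by simp
  qed
  have "((\<lambda>r. ?F int r * ?X r) \<longlongrightarrow> of_int (\<Prod>j = 0..<n. \<Prod>i = 0..<j. int j - int i) * of_nat (card B)) (at_right 1)"
    by (intro tendsto_mult lim X)
  moreover have "((\<lambda>r. ?F int r * ?X r) \<longlongrightarrow> signof revperm * of_int (\<Prod>j = 0..<n. \<Prod>i = 0..<j. shifted j - shifted i)) (at_right 1)"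
    by (rule tendsto_cong[OF ev, THEN iffD2]) (intro tendsto_mult_left lim)
  ultimately have "of_int (\<Prod>j = 0..<n. \<Prod>i = 0..<j. int j - int i) * of_nat (card B) =
      (signof revperm * of_int (\<Prod>j = 0..<n. \<Prod>i = 0..<j. shifted j - shifted i) :: complex)"
    by (rule tendsto_unique[OF trivial_limit_at_right_real])
  then have "complex_of_int ((\<Prod>j = 0..<n. \<Prod>i = 0..<j. int j - int i) * int (card B)) =
      of_int (sign revperm * (\<Prod>j = 0..<n. \<Prod>i = 0..<j. shifted j - shifted i))"
    by simp
  then have eq: "(\<Prod>j = 0..<n. \<Prod>i = 0..<j. int j - int i) * int (card B) =
      sign revperm * (\<Prod>j = 0..<n. \<Prod>i = 0..<j. shifted j - shifted i)"
    by (simp only: of_int_eq_iff)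
  have "(\<Prod>j = 0..<n. \<Prod>i = 0..<j. int j - int i) * int (card B) =
      \<bar>(\<Prod>j = 0..<n. \<Prod>i = 0..<j. int j - int i) * int (card B)\<bar>"
    by (subst abs_of_nonneg) (auto intro!: mult_nonneg_nonneg prod_nonneg)
  also have "\<dots> = (\<Prod>j = 0..<n. \<Prod>i = 0..<j. \<bar>shifted j - shifted i\<bar>)"
    unfolding eq by (simp add: abs_mult abs_prod)
  also have "\<dots> = (\<Prod>j = 0..<n. \<Prod>i = 0..<j. shifted i - shifted j)"
    using shifted_strict_decreasing by (intro prod.cong refl) (fastforce simp: abs_if)
  finally show ?thesis .
qed

end


section \<open>Weight bases and the Casimir operator of a simple module\<close>

text \<open>
  Linearity is required on the span only: a matrix acts linearly on the module, but not necessarily on the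
  ambient vector space.
\<close>
lemma (in vector_space) card_le_if_injective_on_span:
  assumes S: "finite S" "independent S" and T: "finite T"
    and add: "\<And>u w. u \<in> span S \<Longrightarrow> w \<in> span S \<Longrightarrow> f (u + w) = f u + f w"
    and scale: "\<And>c w. w \<in> span S \<Longrightarrow> f (scale c w) = scale c (f w)"
    and ker: "\<And>w. w \<in> span S \<Longrightarrow> f w = 0 \<Longrightarrow> w = 0"
    and im: "\<And>b. b \<in> S \<Longrightarrow> f b \<in> span T"
  shows "card S \<le> card T"
proof -
  have zero: "f 0 = 0" using scale[of 0 0] span_zero by simp
  have f_sum: "f (\<Sum>b\<in>R. scale (u b) b) = (\<Sum>b\<in>R. scale (u b) (f b))" if "R \<subseteq> S" for u R
    using finite_subset[OF that S(1)] that
  proof (induction R rule: finite_induct)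
    case (insert b R)
    then have "b \<in> span S" "(\<Sum>b\<in>R. scale (u b) b) \<in> span S"
      by (auto intro!: span_base span_sum span_scale)
    then show ?case using insert by (simp add: add scale span_scale)
  qed (simp add: zero)
  have coeff: "u b = 0" if "(\<Sum>b\<in>S. scale (u b) (f b)) = 0" "b \<in> S" for u b
  proof -
    have "(\<Sum>b\<in>S. scale (u b) b) \<in> span S"
      by (rule span_sum, rule span_scale, rule span_base)
    moreover have "f (\<Sum>b\<in>S. scale (u b) b) = 0" using that(1) by (simp add: f_sum)
    ultimately have "(\<Sum>b\<in>S. scale (u b) b) = 0" by (rule ker)
    then show ?thesis by (rule independentD[OF S(2,1) subset_refl _ that(2)])
  qed
  have inj: "inj_on f S"
  proof (rule inj_onI)
    fix b b' assume b: "b \<in> S" "b' \<in> S" "f b = f b'"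
    have bs: "b - b' \<in> span S" "b' \<in> span S"
      using b by (intro span_diff span_base; simp)+
    have "f (b - b') + f b' = f b" using add[OF bs] by simp
    then have "b - b' = 0" using b(3) by (intro ker[OF bs(1)]) simp
    then show "b = b'" by simp
  qed
  have "independent (f ` S)"
  proof
    assume "dependent (f ` S)"
    then obtain u v where u: "v \<in> f ` S" "u v \<noteq> 0" "(\<Sum>v\<in>f ` S. scale (u v) v) = 0"
      using dependent_finite[OF finite_imageI[OF S(1)]] by blast
    then obtain b where b: "b \<in> S" "v = f b" by blast
    have "(\<Sum>b\<in>S. scale (u (f b)) (f b)) = 0"
      using u(3) by (simp add: sum.reindex[OF inj])
    then show False using coeff[of "\<lambda>b. u (f b)" b] b u(2) by simp
  qed
  then have "card (f ` S) \<le> card T"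
    using independent_span_bound[OF T] im by auto
  then show ?thesis by (simp add: card_image[OF inj])
qed

definition matrix_unit :: "nat \<Rightarrow> nat \<Rightarrow> nat \<Rightarrow> complex mat" where
  "matrix_unit n k l = mat n n (\<lambda>(i, j). if i = k \<and> j = l then 1 else 0)"

lemma matrix_unit_carrier [simp]: "matrix_unit n k l \<in> carrier_mat n n"
  by (simp add: matrix_unit_def)

lemma matrix_unit_mult:
  assumes "i < n" "j < n" "k < n" "l < n"
  shows "matrix_unit n i j * matrix_unit n k l = (if j = k then matrix_unit n i l else 0\<^sub>m n n)"
proof (rule eq_matI)
  fix a b assume "a < dim_row (if j = k then matrix_unit n i l else 0\<^sub>m n n)"
    "b < dim_col (if j = k then matrix_unit n i l else 0\<^sub>m n n)"
  then have ab: "a < n" "b < n" by (auto simp: matrix_unit_def split: if_splits)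
  have "(matrix_unit n i j * matrix_unit n k l) $$ (a, b) =
      (\<Sum>t = 0..<n. (if a = i \<and> t = j then 1 else 0) * (if t = k \<and> b = l then 1 else 0))"
    using ab by (auto simp: matrix_unit_def scalar_prod_def intro!: sum.cong)
  also have "\<dots> = (\<Sum>t = 0..<n. if t = j then (if a = i \<and> j = k \<and> b = l then 1 else 0) else 0)"
    by (intro sum.cong) auto
  also have "\<dots> = (if j = k then matrix_unit n i l else 0\<^sub>m n n) $$ (a, b)"
    using assms ab by (simp add: matrix_unit_def)
  finally show "(matrix_unit n i j * matrix_unit n k l) $$ (a, b) = (if j = k then matrix_unit n i l else 0\<^sub>m n n) $$ (a, b)" .
qed (auto simp: matrix_unit_def)

context gl_module
begin

abbreviation E :: "nat \<Rightarrow> nat \<Rightarrow> 'v \<Rightarrow> 'v" where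
  "E i j \<equiv> act (matrix_unit n i j)"

lemma V_closed: "0 \<in> V" "v \<in> V \<Longrightarrow> w \<in> V \<Longrightarrow> v + w \<in> V" "v \<in> V \<Longrightarrow> w \<in> V \<Longrightarrow> v - w \<in> V"
  "v \<in> V \<Longrightarrow> c *s v \<in> V" "(\<And>i. i \<in> I \<Longrightarrow> f i \<in> V) \<Longrightarrow> sum f I \<in> V"
  using subspace_V by (auto intro: subspace_0 subspace_add subspace_diff subspace_scale subspace_sum)

lemma act_zero_right: "A \<in> carrier_mat n n \<Longrightarrow> act A 0 = 0"
  using act_scale_right[of A 0 0] V_closed(1) by simp

lemma act_zero_left: "v \<in> V \<Longrightarrow> act (0\<^sub>m n n) v = 0"
  using act_smult_left[of "0\<^sub>m n n" v 0] by (simp add: smult_zero_mat)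

lemma act_sum_right:
  assumes "A \<in> carrier_mat n n" "\<And>i. i \<in> I \<Longrightarrow> f i \<in> V"
  shows "act A (sum f I) = (\<Sum>i\<in>I. act A (f i))"
  using assms(2)
  by (induction I rule: infinite_finite_induct)
     (auto simp: act_zero_right assms(1) act_add_right V_closed)

lemma act_diff_right:
  "A \<in> carrier_mat n n \<Longrightarrow> v \<in> V \<Longrightarrow> w \<in> V \<Longrightarrow> act A (v - w) = act A v - act A w"
  using act_add_right[of A "v - w" w] V_closed(3)[of v w] by (simp add: algebra_simps)

lemma E_closed: "v \<in> V \<Longrightarrow> E i j v \<in> V"
  by (simp add: act_closed)

lemma funpow_E_closed: "v \<in> V \<Longrightarrow> (E i j ^^ r) v \<in> V"
  by (induction r) (auto simp: E_closed)

lemma E_bracket: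
  assumes "i < n" "j < n" "k < n" "l < n" "v \<in> V"
  shows "E i j (E k l v) = E k l (E i j v) + (if j = k then E i l v else 0) - (if i = l then E k j v else 0)"
proof -
  have 1: "act (A - B) v = act A v - act B v" if "A \<in> carrier_mat n n" "B \<in> carrier_mat n n" for A B
  proof -
    have "A - B = A + (- 1) \<cdot>\<^sub>m B" using that by (intro eq_matI) auto
    then show ?thesis using that assms by (simp add: act_add_left act_smult_left)
  qed
  have "act (matrix_unit n i j * matrix_unit n k l - matrix_unit n k l * matrix_unit n i j) v = E i j (E k l v) - E k l (E i j v)"
    using assms by (intro act_bracket) auto
  moreover have "act (matrix_unit n i j * matrix_unit n k l - matrix_unit n k l * matrix_unit n i j) v =
      (if j = k then E i l v else 0) - (if i = l then E k j v else 0)"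
    using assms by (simp add: matrix_unit_mult 1 act_zero_left)
  ultimately show ?thesis by (simp add: algebra_simps)
qed

text \<open>
  The matrix is built up from the matrix units one entry at a time.
\<close>
lemma act_closed_from_E:
  assumes W: "subspace W" "w \<in> W" "w \<in> V" and E: "\<And>i j. i < n \<Longrightarrow> j < n \<Longrightarrow> E i j w \<in> W"
    and A: "A \<in> carrier_mat n n"
  shows "act A w \<in> W"
proof -
  define R where "R S = mat n n (\<lambda>(i, j). if (i, j) \<in> S then A $$ (i, j) else 0)" for S
  have "act (R S) w \<in> W" if "finite S" "S \<subseteq> {..<n} \<times> {..<n}" for S
    using that
  proof (induction S rule: finite_induct)
    case empty
    have "R {} = 0\<^sub>m n n" by (auto simp: R_def)
    then show ?case using W act_zero_left subspace_0 by simp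
  next
    case (insert p S)
    obtain i j where p: "p = (i, j)" by force
    have "R (insert p S) = R S + A $$ (i, j) \<cdot>\<^sub>m matrix_unit n i j"
      using insert.hyps by (intro eq_matI) (auto simp: R_def matrix_unit_def p)
    moreover have "R S \<in> carrier_mat n n" by (simp add: R_def)
    ultimately have "act (R (insert p S)) w = act (R S) w + A $$ (i, j) *s E i j w"
      using W by (simp add: act_add_left act_smult_left)
    then show ?case using insert W E p by (auto intro!: subspace_add subspace_scale)
  qed
  moreover have "R ({..<n} \<times> {..<n}) = A" using A by (intro eq_matI) (auto simp: R_def)
  ultimately show ?thesis by fastforce
qed

definition weight_vector :: "(nat \<Rightarrow> int) \<Rightarrow> 'v \<Rightarrow> bool" where
  "weight_vector \<mu> w \<longleftrightarrow> w \<in> V \<and> (\<forall>i<n. E i i w = of_int (\<mu> i) *s w)"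

lemma weight_vector_E:
  assumes "weight_vector \<mu> w" "i < n" "j < n"
  shows "weight_vector (root_shift i j \<mu>) (E i j w)"
  unfolding weight_vector_def
proof (intro conjI allI impI)
  have w: "w \<in> V" "\<And>k. k < n \<Longrightarrow> E k k w = of_int (\<mu> k) *s w"
    using assms by (auto simp: weight_vector_def)
  show "E i j w \<in> V" using w by (simp add: E_closed)
  fix k assume "k < n"
  have "E k k (E i j w) = E i j (E k k w) + (if k = i then E k j w else 0) - (if k = j then E i k w else 0)"
    using w \<open>k < n\<close> assms by (simp add: E_bracket)
  also have "\<dots> = of_int (root_shift i j \<mu> k) *s E i j w"
    using w \<open>k < n\<close> by (auto simp: act_scale_right root_shift_def scale_left_distrib scale_left_diff_distrib)
  finally show "E k k (E i j w) = of_int (root_shift i j \<mu> k) *s E i j w" .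
qed

inductive_set words :: "'v \<Rightarrow> 'v set" for v where
  words_base: "v \<in> words v"
| words_step: "w \<in> words v \<Longrightarrow> j < i \<Longrightarrow> i < n \<Longrightarrow> E i j w \<in> words v"

lemma words_V: "w \<in> words v \<Longrightarrow> v \<in> V \<Longrightarrow> w \<in> V"
  by (induction rule: words.induct) (auto simp: E_closed)

text \<open>
  A lowering operator \<open>E\<^sub>i\<^sub>j\<close>, \<open>j < i\<close>, takes one unit from position \<open>j\<close> of the weight to the later position
  \<open>i\<close>: no partial sum grows, and the one that ends at \<open>j\<close> drops.
\<close>
lemma words_weight:
  assumes "w \<in> words v" "weight_vector \<nu> v" "\<forall>i\<ge>n. \<nu> i = 0"
  shows "\<exists>\<mu>. weight_vector \<mu> w \<and> dominated n \<mu> \<nu> \<and> (w = v \<or> \<mu> \<noteq> \<nu>)"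
  using assms(1)
proof induction
  case words_base
  then show ?case using assms by (intro exI[of _ \<nu>]) (auto simp: dominated_def)
next
  case (words_step w j i)
  then obtain \<mu> where \<mu>: "weight_vector \<mu> w" "dominated n \<mu> \<nu>" by auto
  have "(\<Sum>a = 0..<Suc j. root_shift i j \<mu> a) < (\<Sum>a = 0..<Suc j. \<nu> a)"
  proof -
    have "(\<Sum>a = 0..<Suc j. \<mu> a) \<le> (\<Sum>a = 0..<Suc j. \<nu> a)"
      using \<mu>(2) words_step(2,3) by (simp add: dominated_def del: sum.op_ivl_Suc)
    then show ?thesis using words_step(2) unfolding sum_root_shift by simp
  qed
  then have "root_shift i j \<mu> \<noteq> \<nu>" by auto
  moreover have "dominated n (root_shift i j \<mu>) \<nu>"
    unfolding dominated_def
  proof (intro conjI allI impI)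
    fix k assume "k \<le> n"
    then have "(\<Sum>a = 0..<k. \<mu> a) \<le> (\<Sum>a = 0..<k. \<nu> a)" using \<mu>(2) by (simp add: dominated_def)
    then show "(\<Sum>a = 0..<k. root_shift i j \<mu> a) \<le> (\<Sum>a = 0..<k. \<nu> a)"
      unfolding sum_root_shift using words_step(2) by (simp add: of_bool_def)
  next
    show "(\<Sum>a = 0..<n. root_shift i j \<mu> a) = (\<Sum>a = 0..<n. \<nu> a)"
      unfolding sum_root_shift using words_step(2,3) \<mu>(2) by (simp add: dominated_def)
  next
    fix a assume "n \<le> a"
    then show "root_shift i j \<mu> a = 0"
      using words_step(2,3) \<mu>(2) by (simp add: dominated_def root_shift_def)
  qed
  ultimately show ?case
    using weight_vector_E[OF \<mu>(1), of i j] words_step(2,3) by (meson less_trans)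
qed


lemma subspace_act_preimage:
  assumes "A \<in> carrier_mat n n" "subspace W"
  shows "subspace {w \<in> V. act A w \<in> W}"
  using assms by (intro subspaceI)
    (auto simp: V_closed act_zero_right act_add_right act_scale_right subspace_0 subspace_add subspace_scale)

lemma span_words_V: "v \<in> V \<Longrightarrow> span (words v) \<subseteq> V"
  by (intro span_minimal subspace_V subsetI) (rule words_V)

lemma E_span_words:
  assumes "v \<in> V" "w \<in> span (words v)" "j < i" "i < n"
  shows "E i j w \<in> span (words v)"
proof -
  have "span (words v) \<subseteq> {w \<in> V. E i j w \<in> span (words v)}"
  proof (intro span_minimal subspace_act_preimage subspace_span subsetI CollectI conjI matrix_unit_carrier)
    fix x assume x: "x \<in> words v"
    show "x \<in> V" using words_V[OF x assms(1)] .
    show "E i j x \<in> span (words v)"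
      by (rule span_base, rule words.words_step) (fact x assms)+
  qed
  then show ?thesis using assms(2) by blast
qed

text \<open>
  A matrix unit is moved to the right through the lowering operators. Each commutator is again a difference of
  matrix units applied to a shorter word, so induction on the word reaches the highest weight vector.
\<close>
lemma submodule_span_words:
  assumes "weight_vector \<nu> v" "\<And>i j. i < j \<Longrightarrow> j < n \<Longrightarrow> E i j v = 0"
  shows "submodule (span (words v))"
proof -
  have v: "v \<in> V" using assms(1) by (simp add: weight_vector_def)
  have E: "E i l w \<in> span (words v)" if "w \<in> words v" "i < n" "l < n" for w i l
    using that
  proof (induction arbitrary: i l)
    case words_base
    consider "i < l" | "i = l" | "l < i" by linarith
    then show ?case
    proof cases
      case 1 then show ?thesis using assms(2) words_base by (simp add: span_zero)
    next
      case 2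
      then have "E i l v = of_int (\<nu> i) *s v"
        using assms(1) words_base by (simp add: weight_vector_def)
      then show ?thesis by (simp add: span_scale span_base words.words_base)
    next
      case 3 then show ?thesis
        using words_base by (intro span_base words.words_step words.words_base) auto
    qed
  next
    case (words_step w j a)
    have "w \<in> V" using words_V[OF words_step(1) v] .
    then have "E i l (E a j w) = E a j (E i l w) + (if l = a then E i j w else 0) - (if i = j then E a l w else 0)"
      using words_step(2,3) words_step.prems by (intro E_bracket) auto
    moreover have "E a j (E i l w) \<in> span (words v)"
      by (rule E_span_words[OF v words_step.IH[OF words_step.prems] words_step(2,3)])
    moreover have "E i j w \<in> span (words v)" "E a l w \<in> span (words v)"
      using words_step by auto
    ultimately show ?case by (auto intro!: span_add span_diff span_zero)
  qed
  have "span (words v) \<subseteq> {w \<in> V. act A w \<in> span (words v)}" if "A \<in> carrier_mat n n" for A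
  proof (intro span_minimal subspace_act_preimage subspace_span that subsetI CollectI conjI)
    fix x assume x: "x \<in> words v"
    show "x \<in> V" using words_V[OF x v] .
    then show "act A x \<in> span (words v)"
      by (rule act_closed_from_E[OF subspace_span span_base[OF x] _ E[OF x] that])
  qed
  then show ?thesis
    using span_words_V[OF v] by (auto simp: submodule_def)
qed

definition casimir :: "'v \<Rightarrow> 'v" where
  "casimir w = (\<Sum>i = 0..<n. \<Sum>j = 0..<n. E i j (E j i w))"

lemma casimir_linear:
  "w \<in> V \<Longrightarrow> u \<in> V \<Longrightarrow> casimir (w + u) = casimir w + casimir u"
  "w \<in> V \<Longrightarrow> casimir (c *s w) = c *s casimir w"
  by (simp_all add: casimir_def act_add_right act_scale_right E_closed sum.distrib scale_sum_right)

text \<open>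
  The commutators with the two factors contribute four single sums, which cancel in pairs.
\<close>
lemma casimir_commutes:
  assumes "k < n" "l < n" "w \<in> V"
  shows "casimir (E k l w) = E k l (casimir w)"
proof -
  have "E k l (casimir w) = (\<Sum>i = 0..<n. \<Sum>j = 0..<n. E k l (E i j (E j i w)))"
    using assms by (simp add: casimir_def act_sum_right E_closed V_closed)
  also have "\<dots> = (\<Sum>i = 0..<n. \<Sum>j = 0..<n. E i j (E j i (E k l w))
      + (if i = l then E k j (E j l w) else 0) - (if j = k then E i l (E k i w) else 0)
      + (if j = l then E i l (E k i w) else 0) - (if i = k then E k j (E j l w) else 0))"
  proof (intro sum.cong refl)
    fix i j assume "i \<in> {0..<n}" "j \<in> {0..<n}"
    then have ij: "i < n" "j < n" by auto
    have "E k l (E i j (E j i w)) = E i j (E k l (E j i w))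
        + (if l = i then E k j (E j i w) else 0) - (if k = j then E i l (E j i w) else 0)"
      using ij assms by (intro E_bracket) (auto simp: E_closed)
    also have "E k l (E j i w) = E j i (E k l w) + (if l = j then E k i w else 0) - (if k = i then E j l w else 0)"
      using ij assms by (intro E_bracket) auto
    also have "E i j \<dots> = E i j (E j i (E k l w)) + (if l = j then E i j (E k i w) else 0) - (if k = i then E i j (E j l w) else 0)"
      using ij assms by (auto simp: act_add_right act_diff_right E_closed V_closed act_zero_right)
    finally show "E k l (E i j (E j i w)) = E i j (E j i (E k l w))
      + (if i = l then E k j (E j l w) else 0) - (if j = k then E i l (E k i w) else 0)
      + (if j = l then E i l (E k i w) else 0) - (if i = k then E k j (E j l w) else 0)"
      by (auto simp: algebra_simps)
  qed
  also have "\<dots> = casimir (E k l w) + (\<Sum>j = 0..<n. E k j (E j l w)) - (\<Sum>i = 0..<n. E i l (E k i w))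
      + (\<Sum>i = 0..<n. E i l (E k i w)) - (\<Sum>j = 0..<n. E k j (E j l w))"
  proof -
    have "(\<Sum>i = 0..<n. \<Sum>j = 0..<n. if i = a then f j else 0) = (\<Sum>j = 0..<n. f j)"
      if "a < n" for a and f :: "nat \<Rightarrow> 'v"
      using that by (subst sum.swap) simp
    moreover have "(\<Sum>i = 0..<n. \<Sum>j = 0..<n. if j = a then f i else 0) = (\<Sum>i = 0..<n. f i)"
      if "a < n" for a and f :: "nat \<Rightarrow> 'v"
      using that by simp
    ultimately show ?thesis
      using assms(1,2) by (simp add: sum.distrib sum_subtractf casimir_def)
  qed
  finally show ?thesis by simp
qed

lemma casimir_scalar_on_words:
  assumes v: "weight_vector \<nu> v" "\<And>i j. i < j \<Longrightarrow> j < n \<Longrightarrow> E i j v = 0"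
  shows "\<exists>c. \<forall>w \<in> span (words v). casimir w = c *s w"
proof -
  have vV: "v \<in> V" using assms(1) by (simp add: weight_vector_def)
  have "\<exists>c. E i j (E j i v) = c *s v" if "i < n" "j < n" for i j
  proof -
    consider "i = j" | "j < i" | "i < j" by linarith
    then show ?thesis
    proof cases
      case 1 then show ?thesis using v that by (auto simp: weight_vector_def act_scale_right)
    next
      case 2 then show ?thesis using v(2)[of j i] that
        by (intro exI[of _ 0]) (simp add: act_zero_right)
    next
      case 3
      have "E i j (E j i v) = E j i (E i j v) + E i i v - E j j v"
        using E_bracket[of i j j i v] that vV by simp
      also have "\<dots> = of_int (\<nu> i - \<nu> j) *s v"
        using 3 v that by (simp add: act_zero_right weight_vector_def scale_left_diff_distrib)
      finally show ?thesis by blast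
    qed
  qed
  then obtain d where d: "\<And>i j. i < n \<Longrightarrow> j < n \<Longrightarrow> E i j (E j i v) = d i j *s v" by metis
  define c where "c = (\<Sum>i = 0..<n. \<Sum>j = 0..<n. d i j)"
  have cv: "casimir v = c *s v"
    by (simp add: casimir_def c_def d scale_sum_left)
  have word: "casimir w = c *s w" if "w \<in> words v" for w
    using that
  proof induction
    case words_base
    show ?case by (fact cv)
  next
    case (words_step w j i)
    then show ?case
      using words_V[OF words_step(1) vV] by (simp add: casimir_commutes act_scale_right)
  qed
  have "subspace {w \<in> V. casimir w = c *s w}"
    by (intro subspaceI)
       (auto simp: V_closed casimir_linear scale_right_distrib scale_left_commute,
        simp add: casimir_def act_zero_right)
  then have "span (words v) \<subseteq> {w \<in> V. casimir w = c *s w}"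
    using word words_V vV by (intro span_minimal) auto
  then show ?thesis by blast
qed

text \<open>
  The commutation rule \<open>e f\<^sup>r\<^sup>+\<^sup>1 = f\<^sup>r\<^sup>+\<^sup>1 e + (r + 1) f\<^sup>r (h - r)\<close> of \<open>sl\<^sub>2\<close>, for \<open>e = E\<^sub>i\<^sub>j\<close> and \<open>f = E\<^sub>j\<^sub>i\<close>.
\<close>
lemma raise_lower_funpow:
  assumes w: "weight_vector \<mu> w" and ij: "i < n" "j < n" "i \<noteq> j"
  shows "E i j ((E j i ^^ Suc r) w) =
    (E j i ^^ Suc r) (E i j w) + of_int (int (Suc r) * (\<mu> i - \<mu> j - int r)) *s (E j i ^^ r) w"
proof -
  have wV: "w \<in> V" using w by (simp add: weight_vector_def)
  have wt: "weight_vector ((root_shift j i ^^ r) \<mu>) ((E j i ^^ r) w)" for r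
    by (induction r) (auto simp: w weight_vector_E ij)
  have diff: "(root_shift j i ^^ r) \<mu> i - (root_shift j i ^^ r) \<mu> j = \<mu> i - \<mu> j - 2 * int r" for r
    using ij by (induction r) (auto simp: root_shift_def)
  have step: "E i j (E j i ((E j i ^^ r) w)) = E j i (E i j ((E j i ^^ r) w))
      + of_int (\<mu> i - \<mu> j - 2 * int r) *s (E j i ^^ r) w" for r
  proof -
    have "E i j (E j i ((E j i ^^ r) w)) = E j i (E i j ((E j i ^^ r) w))
        + E i i ((E j i ^^ r) w) - E j j ((E j i ^^ r) w)"
      using E_bracket[of i j j i "(E j i ^^ r) w"] ij wV by (simp add: funpow_E_closed)
    also have "E i i ((E j i ^^ r) w) = of_int ((root_shift j i ^^ r) \<mu> i) *s (E j i ^^ r) w"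
      using wt ij by (simp add: weight_vector_def)
    also have "E j j ((E j i ^^ r) w) = of_int ((root_shift j i ^^ r) \<mu> j) *s (E j i ^^ r) w"
      using wt ij by (simp add: weight_vector_def)
    finally show ?thesis
      unfolding diff[of r, symmetric] by (simp add: scale_left_diff_distrib)
  qed
  show ?thesis
  proof (induction r)
    case 0
    then show ?case using step[of 0] by simp
  next
    case (Suc r)
    have "E i j ((E j i ^^ Suc (Suc r)) w) = E j i (E i j ((E j i ^^ Suc r) w))
        + of_int (\<mu> i - \<mu> j - 2 * int (Suc r)) *s (E j i ^^ Suc r) w"
      using step[of "Suc r"] by simp
    also have "E j i (E i j ((E j i ^^ Suc r) w)) = (E j i ^^ Suc (Suc r)) (E i j w)
        + of_int (int (Suc r) * (\<mu> i - \<mu> j - int r)) *s (E j i ^^ Suc r) w"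
      unfolding Suc
      using wV by (simp add: act_add_right act_scale_right E_closed V_closed funpow_E_closed del: of_int_mult)
    finally have "E i j ((E j i ^^ Suc (Suc r)) w) = (E j i ^^ Suc (Suc r)) (E i j w)
        + of_int (int (Suc r) * (\<mu> i - \<mu> j - int r) + (\<mu> i - \<mu> j - 2 * int (Suc r))) *s (E j i ^^ Suc r) w"
      by (simp only: of_int_add scale_left_distrib add.assoc)
    also have "int (Suc r) * (\<mu> i - \<mu> j - int r) + (\<mu> i - \<mu> j - 2 * int (Suc r))
        = int (Suc (Suc r)) * (\<mu> i - \<mu> j - int (Suc r))"
      by (simp add: algebra_simps)
    finally show ?case .
  qed
qed

lemma highest_vector_lower_power_injective:
  assumes w: "weight_vector \<mu> w" and ij: "i < n" "j < n" "i \<noteq> j" and "E i j w = 0"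
    and "int r \<le> \<mu> i - \<mu> j" "(E j i ^^ r) w = 0"
  shows "w = 0"
  using assms(6,7)
proof (induction r)
  case (Suc r)
  have "(E j i ^^ Suc r) 0 = 0" by (induction r) (auto simp: act_zero_right)
  then have "of_int (int (Suc r) * (\<mu> i - \<mu> j - int r)) *s (E j i ^^ r) w = 0"
    using raise_lower_funpow[OF w ij, of r] Suc.prems(2) assms(5) by (simp add: act_zero_right)
  moreover have "complex_of_int (int (Suc r) * (\<mu> i - \<mu> j - int r)) \<noteq> 0"
    unfolding of_int_eq_0_iff using Suc.prems(1) by simp
  ultimately have "(E j i ^^ r) w = 0" by (metis scale_eq_0_iff)
  then show ?case using Suc by simp
qed simp

text \<open>
  On vectors of \<open>sl\<^sub>2\<close>-weight \<open>k\<close> the map \<open>f\<^sup>k\<close> is injective. If \<open>f\<^sup>k w = 0\<close>, then the commutation rule gives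
  \<open>f\<^sup>k\<^sup>+\<^sup>2 (e w) = 0\<close>, where the correction term vanishes because it is a multiple of \<open>f\<^sup>k\<^sup>+\<^sup>1 w\<close>.
  As \<open>e w\<close> has weight \<open>k + 2\<close>, descending induction gives \<open>e w = 0\<close>, and then \<open>w = 0\<close>. The bound \<open>M\<close> on the
  weights starts the induction.
\<close>
lemma lower_power_injective:
  assumes bound: "\<And>\<mu> w. weight_vector \<mu> w \<Longrightarrow> M < \<mu> i - \<mu> j \<Longrightarrow> w = 0"
    and ij: "i < n" "j < n" "i \<noteq> j"
    and "weight_vector \<mu> w" "\<mu> i - \<mu> j = int k" "(E j i ^^ k) w = 0"
  shows "w = 0"
  using assms(5-7)
proof (induction "nat (M + 1 - int k)" arbitrary: k \<mu> w rule: less_induct)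
  case less
  show ?case
  proof (cases "M < int k")
    case True
    then show ?thesis using bound less.prems by metis
  next
    case False
    have wV: "w \<in> V" using less.prems by (simp add: weight_vector_def)
    have f0: "(E j i ^^ Suc k) w = 0" "(E j i ^^ Suc (Suc k)) w = 0"
      using less.prems(3) by (auto simp: act_zero_right)
    have "(E j i ^^ (k + 2)) (E i j w) = 0"
      using raise_lower_funpow[OF less.prems(1) ij, of "Suc k"] unfolding f0
      by (simp add: act_zero_right)
    moreover have "root_shift i j \<mu> i - root_shift i j \<mu> j = int (k + 2)"
      using less.prems(2) ij by (simp add: root_shift_def)
    ultimately have "E i j w = 0"
      using less.hyps[of "k + 2" "root_shift i j \<mu>" "E i j w"] False weight_vector_E less.prems(1) ij
      by auto
    then show ?thesis
      using highest_vector_lower_power_injective[OF less.prems(1) ij _ _ less.prems(3)] less.prems(2) by simp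
  qed
qed

context
  fixes B :: "'v set" and wt :: "'v \<Rightarrow> nat \<Rightarrow> int"
  assumes B: "finite B" "independent B" "span B = V"
    and wt: "\<And>b. b \<in> B \<Longrightarrow> weight_vector (wt b) b"
begin

lemma basis_in_V: "b \<in> B \<Longrightarrow> b \<in> V"
  using B span_base by blast

lemma sum_representation_basis: "w \<in> V \<Longrightarrow> (\<Sum>b\<in>B. representation B w b *s b) = w"
  using B by (intro sum_representation_eq) auto

lemma weight_vector_support:
  assumes w: "weight_vector \<mu> w" and b: "b \<in> B" "representation B w b \<noteq> 0" and "i < n"
  shows "wt b i = \<mu> i"
proof -
  let ?r = "representation B w"
  have wV: "w \<in> V" using w by (simp add: weight_vector_def)
  have "E i i w = (\<Sum>b\<in>B. E i i (?r b *s b))"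
    using act_sum_right[of "matrix_unit n i i" B "\<lambda>b. ?r b *s b"] sum_representation_basis[OF wV]
    by (simp add: basis_in_V V_closed)
  also have "\<dots> = (\<Sum>b\<in>B. (?r b * of_int (wt b i)) *s b)"
    using wt \<open>i < n\<close> by (intro sum.cong) (auto simp: act_scale_right basis_in_V weight_vector_def)
  finally have 1: "E i i w = (\<Sum>b\<in>B. (?r b * of_int (wt b i)) *s b)" .
  have "of_int (\<mu> i) *s w = of_int (\<mu> i) *s (\<Sum>b\<in>B. ?r b *s b)"
    using sum_representation_basis[OF wV] by simp
  then have "of_int (\<mu> i) *s w = (\<Sum>b\<in>B. (of_int (\<mu> i) * ?r b) *s b)"
    by (simp add: scale_sum_right)
  then have "(\<Sum>b\<in>B. (?r b * of_int (wt b i) - of_int (\<mu> i) * ?r b) *s b) = 0"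
    using 1 w \<open>i < n\<close> by (simp add: weight_vector_def scale_left_diff_distrib sum_subtractf)
  then have "?r b * of_int (wt b i) - of_int (\<mu> i) * ?r b = 0"
    by (rule independentD[OF B(2,1) subset_refl _ b(1)])
  then show ?thesis using b(2) by (simp add: mult.commute)
qed

lemma weight_vector_in_span:
  assumes w: "weight_vector \<mu> w"
  shows "w \<in> span {b \<in> B. \<forall>i<n. wt b i = \<mu> i}"
proof -
  have wV: "w \<in> V" using w by (simp add: weight_vector_def)
  have "representation B w b *s b \<in> span {b \<in> B. \<forall>i<n. wt b i = \<mu> i}" if "b \<in> B" for b
  proof (cases "representation B w b = 0")
    case False
    then show ?thesis
      using weight_vector_support[OF w that] that by (intro span_scale span_base) auto
  qed (simp add: span_zero)
  then have "(\<Sum>b\<in>B. representation B w b *s b) \<in> span {b \<in> B. \<forall>i<n. wt b i = \<mu> i}"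
    by (rule span_sum)
  then show ?thesis unfolding sum_representation_basis[OF wV] .
qed

text \<open>
  A weight and its reflection are opposite ends of a string for the root \<open>\<epsilon>\<^sub>i - \<epsilon>\<^sub>j\<close>, so a power of the
  lowering operator maps the one weight space injectively into the other.
\<close>
lemma weight_multiplicity_reflect_le:
  assumes ij: "i < n" "j < n" "i \<noteq> j" and le: "\<mu> j \<le> \<mu> i"
  shows "card {b \<in> B. \<forall>a<n. wt b a = \<mu> a} \<le> card {b \<in> B. \<forall>a<n. wt b a = (\<mu> \<circ> transpose i j) a}"
    (is "card ?S \<le> card ?S'")
proof -
  define M where "M = Max (insert 0 ((\<lambda>b. wt b i - wt b j) ` B))"
  have bound: "w = 0" if "weight_vector \<nu> w" "M < \<nu> i - \<nu> j" for \<nu> w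
  proof -
    have "wt b i - wt b j \<le> M" if "b \<in> B" for b
      unfolding M_def using B that by (intro Max_ge) auto
    then have "\<not> (\<forall>i<n. wt b i = \<nu> i)" if "b \<in> B" for b
      using that \<open>M < \<nu> i - \<nu> j\<close> ij(1,2) by (metis linorder_not_less)
    then have none: "{b \<in> B. \<forall>i<n. wt b i = \<nu> i} = {}" by blast
    show ?thesis using weight_vector_in_span[OF that(1)] unfolding none by simp
  qed
  obtain k where k: "\<mu> i - \<mu> j = int k" using le by (metis diff_ge_0_iff_ge nonneg_int_cases)
  have wS: "weight_vector \<mu> b" if "b \<in> ?S" for b
    using wt[of b] that by (auto simp: weight_vector_def)
  have "subspace {w. weight_vector \<mu> w}"
    by (intro subspaceI)
       (auto simp: weight_vector_def V_closed act_zero_right act_add_right act_scale_right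
         scale_right_distrib scale_left_commute)
  then have wspan: "span ?S \<subseteq> {w. weight_vector \<mu> w}"
    using wS by (intro span_minimal) auto
  show ?thesis
  proof (rule card_le_if_injective_on_span[where f = "E j i ^^ k"])
    show "finite ?S" "finite ?S'" using B(1) by auto
    show "independent ?S" by (rule independent_mono[OF B(2)]) auto
    fix u w assume "u \<in> span ?S" "w \<in> span ?S"
    then have "u \<in> V" "w \<in> V" using wspan by (auto simp: weight_vector_def)
    then show "(E j i ^^ k) (u + w) = (E j i ^^ k) u + (E j i ^^ k) w"
      by (induction k) (simp_all add: act_add_right funpow_E_closed)
  next
    fix c w assume "w \<in> span ?S"
    then have "w \<in> V" using wspan by (auto simp: weight_vector_def)
    then show "(E j i ^^ k) (c *s w) = c *s (E j i ^^ k) w"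
      by (induction k) (simp_all add: act_scale_right funpow_E_closed)
  next
    fix w assume w: "w \<in> span ?S" "(E j i ^^ k) w = 0"
    then have "weight_vector \<mu> w" using wspan by blast
    then show "w = 0"
    proof (rule lower_power_injective[of M i j \<mu> w k, OF _ ij _ k w(2), rotated])
      show "u = 0" if "weight_vector \<nu> u" "M < \<nu> i - \<nu> j" for \<nu> u
        using that by (rule bound)
    qed
  next
    fix b assume b: "b \<in> ?S"
    have wf: "weight_vector ((root_shift j i ^^ r) \<mu>) ((E j i ^^ r) b)" for r
      by (induction r) (simp_all add: weight_vector_E ij wS[OF b])
    have sh: "(root_shift j i ^^ r) \<mu> a = \<mu> a + (if a = j then int r else 0) - (if a = i then int r else 0)" for r a
      by (induction r) (auto simp: root_shift_def)
    have "(root_shift j i ^^ k) \<mu> = \<mu> \<circ> transpose i j"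
      using ij k by (auto simp: fun_eq_iff sh transpose_def)
    then show "(E j i ^^ k) b \<in> span ?S'" using weight_vector_in_span[OF wf[of k]] by simp
  qed
qed

lemma weight_multiplicity_reflect:
  assumes "i < n" "j < n"
  shows "card {b \<in> B. \<forall>a<n. wt b a = (\<mu> \<circ> transpose i j) a} = card {b \<in> B. \<forall>a<n. wt b a = \<mu> a}"
proof (cases "i = j")
  case False
  have le: "card {b \<in> B. \<forall>a<n. wt b a = \<nu> a} \<le> card {b \<in> B. \<forall>a<n. wt b a = (\<nu> \<circ> transpose i j) a}" for \<nu>
  proof (cases "\<nu> j \<le> \<nu> i")
    case True
    show ?thesis by (rule weight_multiplicity_reflect_le[OF assms \<open>i \<noteq> j\<close> True])
  next
    case False
    then have "\<nu> i \<le> \<nu> j" by simp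
    then show ?thesis
      using weight_multiplicity_reflect_le[OF assms(2,1), of \<nu>] \<open>i \<noteq> j\<close>
      unfolding transpose_commute[of j i] by blast
  qed
  have twice: "\<mu> \<circ> transpose i j \<circ> transpose i j = \<mu>" by (auto simp: fun_eq_iff)
  show ?thesis
    using le[of "\<mu> \<circ> transpose i j"] unfolding twice by (rule order_antisym) (rule le)
qed simp

definition matrix_entry :: "nat \<Rightarrow> nat \<Rightarrow> 'v \<Rightarrow> 'v \<Rightarrow> complex" where
  "matrix_entry i j b b' = representation B (E i j b) b'"

text \<open>
  The diagonal matrix entry at \<open>b\<close> of the operator \<open>E\<^sub>j\<^sub>i E\<^sub>i\<^sub>j\<close>, as a sum over paths from \<open>b\<close> back to \<open>b\<close>.
\<close>
definition loop_coefficient :: "nat \<Rightarrow> nat \<Rightarrow> 'v \<Rightarrow> complex" where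
  "loop_coefficient i j b = (\<Sum>b'\<in>B. matrix_entry i j b b' * matrix_entry j i b' b)"

lemma representation_V:
  "u \<in> V \<Longrightarrow> w \<in> V \<Longrightarrow> representation B (u + w) b = representation B u b + representation B w b"
  "u \<in> V \<Longrightarrow> w \<in> V \<Longrightarrow> representation B (u - w) b = representation B u b - representation B w b"
  "w \<in> V \<Longrightarrow> representation B (c *s w) b = c * representation B w b"
  "(\<And>i. i \<in> I \<Longrightarrow> g i \<in> V) \<Longrightarrow> representation B (sum g I) b = (\<Sum>i\<in>I. representation B (g i) b)"
  "b' \<in> B \<Longrightarrow> representation B b' b = (if b' = b then 1 else 0)"
proof -
  have span: "u \<in> V \<Longrightarrow> u \<in> span B" for u using B(3) by simp
  show "u \<in> V \<Longrightarrow> w \<in> V \<Longrightarrow> representation B (u + w) b = representation B u b + representation B w b"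
    "u \<in> V \<Longrightarrow> w \<in> V \<Longrightarrow> representation B (u - w) b = representation B u b - representation B w b"
    "w \<in> V \<Longrightarrow> representation B (c *s w) b = c * representation B w b"
    "(\<And>i. i \<in> I \<Longrightarrow> g i \<in> V) \<Longrightarrow> representation B (sum g I) b = (\<Sum>i\<in>I. representation B (g i) b)"
    "b' \<in> B \<Longrightarrow> representation B b' b = (if b' = b then 1 else 0)"
    by (simp_all add: representation_add[OF B(2)] representation_diff[OF B(2)]
      representation_scale[OF B(2)] representation_sum[OF B(2)] representation_basis[OF B(2)] span)
qed

lemma loop_coefficient_eq:
  assumes "b \<in> B"
  shows "representation B (E j i (E i j b)) b = loop_coefficient i j b"
proof -
  have "E j i (E i j b) = (\<Sum>b'\<in>B. matrix_entry i j b b' *s E j i b')"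
    using sum_representation_basis[of "E i j b"] act_sum_right[of "matrix_unit n j i" B "\<lambda>b'. matrix_entry i j b b' *s b'"] assms
    by (simp add: matrix_entry_def E_closed basis_in_V V_closed act_scale_right)
  then show ?thesis
    by (simp add: representation_V E_closed basis_in_V V_closed loop_coefficient_def matrix_entry_def)
qed

lemma loop_coefficient_swap:
  assumes "b \<in> B" "i < n" "j < n"
  shows "loop_coefficient j i b = loop_coefficient i j b + of_int (wt b i - wt b j)"
proof -
  have "E i j (E j i b) = E j i (E i j b) + E i i b - E j j b"
    using E_bracket[of i j j i b] assms basis_in_V by simp
  also have "\<dots> = E j i (E i j b) + of_int (wt b i - wt b j) *s b"
    using wt[OF assms(1)] assms(2,3) by (simp add: weight_vector_def scale_left_diff_distrib)
  finally have "representation B (E i j (E j i b)) b =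
      representation B (E j i (E i j b)) b + of_int (wt b i - wt b j)"
    using assms by (simp add: representation_V E_closed basis_in_V V_closed)
  then show ?thesis using loop_coefficient_eq assms by simp
qed

lemma loop_coefficient_diag:
  assumes "b \<in> B" "i < n"
  shows "loop_coefficient i i b = (of_int (wt b i))\<^sup>2"
proof -
  have "E i i (E i i b) = (of_int (wt b i))\<^sup>2 *s b"
    using wt[OF assms(1)] assms by (simp add: weight_vector_def act_scale_right power2_eq_square)
  then show ?thesis
    using loop_coefficient_eq[OF assms(1), of i i] assms by (simp add: representation_V basis_in_V)
qed

text \<open>
  Cyclicity of the trace: a path from \<open>b\<close> through \<open>b'\<close> back to \<open>b\<close> can also be started at \<open>b'\<close>, whose weight
  differs from that of \<open>b\<close> by the root, so the monomial changes by \<open>x\<^sub>i / x\<^sub>j\<close>. On the other hand, the two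
  orders of \<open>E\<^sub>i\<^sub>j\<close> and \<open>E\<^sub>j\<^sub>i\<close> differ by a diagonal matrix. The two relations determine the sum.
\<close>
lemma loop_coefficient_sum:
  assumes x: "\<And>k. k < n \<Longrightarrow> x k \<noteq> 0" "inj_on x {0..<n}" and ij: "i < n" "j < n" "i \<noteq> j"
  shows "(\<Sum>b\<in>B. loop_coefficient i j b * weight_monomial n x (wt b)) =
    x j / (x i - x j) * (\<Sum>b\<in>B. of_int (wt b i - wt b j) * weight_monomial n x (wt b))"
    (is "?T i j = _ * ?P")
proof -
  let ?m = "\<lambda>b. weight_monomial n x (wt b)"
  have mon: "matrix_entry i j b b' * ?m b' = matrix_entry i j b b' * (x i / x j * ?m b)" if b: "b \<in> B" "b' \<in> B" for b b'
  proof (cases "matrix_entry i j b b' = 0")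
    case False
    have "wt b' k = root_shift i j (wt b) k" if "k < n" for k
      using weight_vector_support[OF weight_vector_E[OF wt[OF b(1)] ij(1,2)] b(2)] False that
      by (simp add: matrix_entry_def)
    then have "?m b' = weight_monomial n x (root_shift i j (wt b))"
      by (simp add: weight_monomial_def)
    then show ?thesis using weight_monomial_root_shift[of n x i j "wt b"] x(1) ij by simp
  qed simp
  have "?T j i = (\<Sum>b'\<in>B. \<Sum>b\<in>B. matrix_entry j i b' b * (matrix_entry i j b b' * ?m b'))"
    by (simp add: loop_coefficient_def sum_distrib_right mult.assoc)
  also have "\<dots> = (\<Sum>b'\<in>B. \<Sum>b\<in>B. matrix_entry j i b' b * (matrix_entry i j b b' * (x i / x j * ?m b)))"
    by (intro sum.cong refl) (simp only: mon)
  also have "\<dots> = x i / x j * ?T i j"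
    by (subst sum.swap) (simp add: loop_coefficient_def sum_distrib_right sum_distrib_left mult_ac)
  finally have 1: "?T j i = x i / x j * ?T i j" .
  have "?T j i = ?T i j + ?P"
    using ij by (simp add: loop_coefficient_swap[of _ i j] sum.distrib distrib_right del: of_int_diff)
  then have "(x i / x j - 1) * ?T i j = ?P"
    using 1 by (simp add: algebra_simps)
  moreover have "x i - x j \<noteq> 0" "x j \<noteq> 0" using x ij by (auto simp: inj_on_def)
  ultimately show ?thesis by (simp add: field_simps)
qed

text \<open>
  The trace of the Casimir operator against the weight monomials, computed from its diagonal entries and from
  its scalar action. The summands with \<open>i = j\<close> give the squared norm of the weights.
\<close>
lemma casimir_trace:
  assumes x: "\<And>k. k < n \<Longrightarrow> x k \<noteq> 0" "inj_on x {0..<n}"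
    and cas: "\<And>w. w \<in> V \<Longrightarrow> casimir w = c *s w"
  shows "(\<Sum>b\<in>B. (\<Sum>i = 0..<n. (of_int (wt b i))\<^sup>2) * weight_monomial n x (wt b)) +
    (\<Sum>i = 0..<n. \<Sum>j \<in> {0..<n} - {i}.
       x j / (x i - x j) * (\<Sum>b\<in>B. of_int (wt b i - wt b j) * weight_monomial n x (wt b))) =
    c * (\<Sum>b\<in>B. weight_monomial n x (wt b))"
proof -
  let ?m = "\<lambda>b. weight_monomial n x (wt b)"
  have "(\<Sum>i = 0..<n. \<Sum>j = 0..<n. loop_coefficient i j b) = c" if "b \<in> B" for b
  proof -
    have "representation B (casimir b) b = (\<Sum>i = 0..<n. \<Sum>j = 0..<n. loop_coefficient j i b)"
      unfolding casimir_def using that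
      by (simp add: representation_V E_closed basis_in_V V_closed loop_coefficient_eq)
    moreover have "representation B (casimir b) b = c"
      using that by (simp add: cas basis_in_V representation_V)
    ultimately show ?thesis by (subst sum.swap) simp
  qed
  then have "c * (\<Sum>b\<in>B. ?m b) = (\<Sum>b\<in>B. (\<Sum>i = 0..<n. \<Sum>j = 0..<n. loop_coefficient i j b) * ?m b)"
    by (simp add: sum_distrib_left)
  also have "\<dots> = (\<Sum>b\<in>B. \<Sum>i = 0..<n. \<Sum>j = 0..<n. loop_coefficient i j b * ?m b)"
    by (simp add: sum_distrib_right)
  also have "\<dots> = (\<Sum>i = 0..<n. \<Sum>b\<in>B. \<Sum>j = 0..<n. loop_coefficient i j b * ?m b)"
    by (rule sum.swap)
  also have "\<dots> = (\<Sum>i = 0..<n. \<Sum>j = 0..<n. \<Sum>b\<in>B. loop_coefficient i j b * ?m b)"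
    by (intro sum.cong refl sum.swap)
  also have "\<dots> = (\<Sum>i = 0..<n. (\<Sum>b\<in>B. (of_int (wt b i))\<^sup>2 * ?m b) +
      (\<Sum>j \<in> {0..<n} - {i}. x j / (x i - x j) * (\<Sum>b\<in>B. of_int (wt b i - wt b j) * ?m b)))"
  proof (intro sum.cong refl)
    fix i assume i: "i \<in> {0..<n}"
    have "(\<Sum>j = 0..<n. \<Sum>b\<in>B. loop_coefficient i j b * ?m b) = (\<Sum>b\<in>B. loop_coefficient i i b * ?m b) +
        (\<Sum>j \<in> {0..<n} - {i}. \<Sum>b\<in>B. loop_coefficient i j b * ?m b)"
      using i by (intro sum.remove) auto
    also have "(\<Sum>b\<in>B. loop_coefficient i i b * ?m b) = (\<Sum>b\<in>B. (of_int (wt b i))\<^sup>2 * ?m b)"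
      using i by (intro sum.cong) (auto simp: loop_coefficient_diag)
    also have "(\<Sum>j \<in> {0..<n} - {i}. \<Sum>b\<in>B. loop_coefficient i j b * ?m b) =
        (\<Sum>j \<in> {0..<n} - {i}. x j / (x i - x j) * (\<Sum>b\<in>B. of_int (wt b i - wt b j) * ?m b))"
      using i x by (intro sum.cong refl loop_coefficient_sum) auto
    finally show "(\<Sum>j = 0..<n. \<Sum>b\<in>B. loop_coefficient i j b * ?m b) = (\<Sum>b\<in>B. (of_int (wt b i))\<^sup>2 * ?m b) +
        (\<Sum>j \<in> {0..<n} - {i}. x j / (x i - x j) * (\<Sum>b\<in>B. of_int (wt b i - wt b j) * ?m b))" .
  qed
  also have "\<dots> = (\<Sum>b\<in>B. (\<Sum>i = 0..<n. (of_int (wt b i))\<^sup>2) * ?m b) +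
      (\<Sum>i = 0..<n. \<Sum>j \<in> {0..<n} - {i}. x j / (x i - x j) * (\<Sum>b\<in>B. of_int (wt b i - wt b j) * ?m b))"
    by (simp add: sum.distrib sum_distrib_right sum.swap[of _ B])
  finally show ?thesis by simp
qed

end

end

definition highest :: "nat \<Rightarrow> int list \<Rightarrow> nat \<Rightarrow> int" where
  "highest n \<mu> = (\<lambda>i. if i < n then \<mu> ! i else 0)"

context simple_gl_module
begin

text \<open>
  The highest weight vector is completed to a basis by words. Every word other than the highest weight
  vector has a strictly smaller weight, so the highest weight occurs once.
\<close>
lemma weight_basis:
  obtains B v wt c where "finite B" "independent B" "span B = V" "v \<in> B"
    "\<And>b. b \<in> B \<Longrightarrow> weight_vector (wt b) b"
    "\<And>b. b \<in> B \<Longrightarrow> dominated n (wt b) (highest n \<mu>)"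
    "\<And>b. b \<in> B \<Longrightarrow> wt b = highest n \<mu> \<longleftrightarrow> b = v"
    "\<And>w. w \<in> V \<Longrightarrow> casimir w = c *s w"
proof -
  obtain v where v: "highest_weight_vector \<mu> v" "v \<noteq> 0"
    using highest_weight by (auto simp: has_highest_weight_def highest_weight_vector_def)
  have raise: "E i j v = 0" if "i < j" "j < n" for i j
  proof -
    have "\<forall>a<n. \<forall>b\<le>a. matrix_unit n i j $$ (a, b) = 0" using that by (auto simp: matrix_unit_def)
    then show ?thesis using v by (auto simp: highest_weight_vector_def)
  qed
  have wv: "weight_vector (highest n \<mu>) v"
    unfolding weight_vector_def
  proof (intro conjI allI impI)
    show "v \<in> V" using v by (simp add: highest_weight_vector_def)
    fix i assume i: "i < n"
    have "diagonal_mat (matrix_unit n i i)" by (auto simp: diagonal_mat_def matrix_unit_def)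
    then have "E i i v = (\<Sum>k<n. of_int (\<mu> ! k) * matrix_unit n i i $$ (k, k)) *s v"
      using v by (simp add: highest_weight_vector_def)
    also have "(\<Sum>k<n. of_int (\<mu> ! k) * matrix_unit n i i $$ (k, k)) = (\<Sum>k<n. if k = i then of_int (\<mu> ! k) else 0)"
      by (intro sum.cong) (auto simp: matrix_unit_def)
    finally show "E i i v = of_int (highest n \<mu> i) *s v" using i by (simp add: highest_def)
  qed
  have V: "span (words v) = V"
  proof -
    have "v \<in> span (words v)" by (intro span_base words.words_base)
    then show ?thesis
      using simple submodule_span_words[OF wv raise] v(2) by (auto simp: simple_def)
  qed
  have "\<exists>c. \<forall>w\<in>V. casimir w = c *s w"
    using casimir_scalar_on_words[OF wv raise] V by simp
  then obtain c where c: "\<And>w. w \<in> V \<Longrightarrow> casimir w = c *s w" by blast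
  have "independent {v}" using v(2) by simp
  then obtain B where B: "{v} \<subseteq> B" "B \<subseteq> words v" "independent B" "words v \<subseteq> span B"
    using maximal_independent_subset_extend[of "{v}" "words v"] words.words_base by auto
  have sB: "span B = V"
    using B V by (metis span_mono span_span subset_antisym)
  have fB: "finite B"
  proof -
    obtain B0 where "finite B0" "span B0 = V" using finite_dim by (auto simp: finite_dim_def)
    moreover have "B \<subseteq> V" using sB span_superset by blast
    ultimately show ?thesis using independent_span_bound B(3) by blast
  qed
  have "\<exists>\<nu>. weight_vector \<nu> b \<and> dominated n \<nu> (highest n \<mu>) \<and> (\<nu> = highest n \<mu> \<longleftrightarrow> b = v)" if "b \<in> B" for b
  proof (cases "b = v")
    case True
    then show ?thesis
      using wv by (intro exI[of _ "highest n \<mu>"]) (auto simp: dominated_def highest_def)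
  next
    case False
    have "b \<in> words v" using B that by blast
    moreover have "\<forall>i\<ge>n. highest n \<mu> i = 0" by (simp add: highest_def)
    ultimately show ?thesis using words_weight[OF _ wv] False by blast
  qed
  then obtain wt where "\<And>b. b \<in> B \<Longrightarrow> weight_vector (wt b) b \<and> dominated n (wt b) (highest n \<mu>) \<and>
      (wt b = highest n \<mu> \<longleftrightarrow> b = v)" by metis
  then show ?thesis using that[of B v wt c] fB B sB c by blast
qed

end


section \<open>The hook content formula and the dimension identity\<close>

lemma simple_gl_module_dim_hook_product:
  assumes \<pi>: "is_partition \<pi>" and M: "simple_gl_module scale n V act (weight_of_partition n \<pi>)"
  shows "int (vector_space.dim scale V) * int (hook_product \<pi>) = content_product n \<pi>"
proof -
  let ?\<mu> = "weight_of_partition n \<pi>"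
  interpret simple_gl_module scale n V act ?\<mu> by (fact M)
  have "length ?\<mu> = n" using highest_weight by (simp add: has_highest_weight_def)
  then have n: "length \<pi> \<le> n" by (simp add: weight_of_partition_def)
  have row: "highest n ?\<mu> i = int (row_length \<pi> i)" if "i < n" for i
    using that by (simp add: highest_def weight_of_partition_def row_length_def nth_append)
  obtain B v wt c where B: "finite B" "independent B" "span B = V" "v \<in> B"
      "\<And>b. b \<in> B \<Longrightarrow> weight_vector (wt b) b"
      "\<And>b. b \<in> B \<Longrightarrow> dominated n (wt b) (highest n ?\<mu>)"
      "\<And>b. b \<in> B \<Longrightarrow> wt b = highest n ?\<mu> \<longleftrightarrow> b = v"
      "\<And>w. w \<in> V \<Longrightarrow> casimir w = scale c w"
    by (rule weight_basis) (rule that)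
  interpret radial_character n B wt "highest n ?\<mu>" v c
  proof (rule radial_character.intro)
    show "finite B" "v \<in> B" by (fact B)+
    show "dominated n (wt b) (highest n ?\<mu>)" "wt b = highest n ?\<mu> \<longleftrightarrow> b = v" if "b \<in> B" for b
      using that by (fact B)+
    show "highest n ?\<mu> j \<le> highest n ?\<mu> i" if "i \<le> j" "j < n" for i j
      using that row row_length_antimono[OF \<pi> that(1)] by simp
    show "card {b \<in> B. \<forall>a<n. wt b a = (\<nu> \<circ> transpose i j) a} = card {b \<in> B. \<forall>a<n. wt b a = \<nu> a}"
      if "i < n" "j < n" for i j \<nu>
      by (rule weight_multiplicity_reflect[OF B(1-3) B(5) that])
    show "(\<Sum>b\<in>B. (\<Sum>i = 0..<n. (of_int (wt b i))\<^sup>2) * weight_monomial n x (wt b)) +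
      (\<Sum>i = 0..<n. \<Sum>j \<in> {0..<n} - {i}.
         x j / (x i - x j) * (\<Sum>b\<in>B. of_int (wt b i - wt b j) * weight_monomial n x (wt b))) =
      c * (\<Sum>b\<in>B. weight_monomial n x (wt b))"
      if "\<And>k. k < n \<Longrightarrow> x k \<noteq> 0" "inj_on x {0..<n}" for x
      by (rule casimir_trace[OF B(1-3) B(5) that B(8)])
  qed
  have "dim V = card B"
    using dim_span_eq_card_independent[OF B(2)] by (simp add: B(3))
  then have "int (dim V) * int (hook_product \<pi>) = int (card B) * int (hook_product \<pi>)" by simp
  also have "\<dots> = content_product n \<pi>"
  proof (rule hook_content[OF \<pi> n])
    have "(\<Prod>j = 0..<n. \<Prod>i = 0..<j. shifted i - shifted j) =
      (\<Prod>j = 0..<n. \<Prod>i = 0..<j. (int (row_length \<pi> i) + (int n - 1 - int i)) - (int (row_length \<pi> j) + (int n - 1 - int j)))"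
      by (intro prod.cong refl) (simp add: shifted_def row)
    then show "(\<Prod>j = 0..<n. \<Prod>i = 0..<j. int j - int i) * int (card B) =
      (\<Prod>j = 0..<n. \<Prod>i = 0..<j. (int (row_length \<pi> i) + (int n - 1 - int i)) - (int (row_length \<pi> j) + (int n - 1 - int j)))"
      using weyl_dimension by simp
  qed
  finally show ?thesis .
qed

theorem theorem2p1:
  fixes p q m :: nat and \<pi> \<alpha> \<beta> :: "nat list"
    and scale1 :: "complex \<Rightarrow> 'a::ab_group_add \<Rightarrow> 'a"
    and scale2 :: "complex \<Rightarrow> 'b::ab_group_add \<Rightarrow> 'b"
    and scale3 :: "complex \<Rightarrow> 'c::ab_group_add \<Rightarrow> 'c"
    and scale4 :: "complex \<Rightarrow> 'd::ab_group_add \<Rightarrow> 'd"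
  assumes "p > 0" and "q > 0"
    and "is_partition \<pi>" and "young_diagram \<pi> \<subseteq> {..<p} \<times> {..<q}"
    and "\<alpha> = frobenius_arms \<pi>" and "\<beta> = frobenius_legs \<pi>"
    and "simple_gl_module scale1 p V1 act1
           (weight_of_partition p (frobenius_partition (map (\<lambda>a. a + m) \<alpha>) \<beta>))"
    and "simple_gl_module scale2 q V2 act2
           (weight_of_partition q (frobenius_partition (map (\<lambda>b. b + m) \<beta>) \<alpha>))"
    and "simple_gl_module scale3 (p + m) V3 act3
           (weight_of_partition (p + m) (frobenius_partition \<alpha> (map (\<lambda>b. b + m) \<beta>)))"
    and "simple_gl_module scale4 (q + m) V4 act4
           (weight_of_partition (q + m) (frobenius_partition \<beta> (map (\<lambda>a. a + m) \<alpha>)))"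
  shows "vector_space.dim scale1 V1 * vector_space.dim scale2 V2 =
         vector_space.dim scale3 V3 * vector_space.dim scale4 V4"
proof -
  let ?up = "map (\<lambda>a. a + m)"
  let ?P1 = "frobenius_partition (?up \<alpha>) \<beta>" and ?P2 = "frobenius_partition (?up \<beta>) \<alpha>"
  let ?P3 = "frobenius_partition \<alpha> (?up \<beta>)" and ?P4 = "frobenius_partition \<beta> (?up \<alpha>)"
  let ?d1 = "int (vector_space.dim scale1 V1)" and ?d2 = "int (vector_space.dim scale2 V2)"
  let ?d3 = "int (vector_space.dim scale3 V3)" and ?d4 = "int (vector_space.dim scale4 V4)"
  let ?H = "\<lambda>\<rho>. int (hook_product \<rho>)"
  have len: "length \<alpha> = length \<beta>" using assms(5,6) by (simp add: length_frobenius)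
  have dec: "sorted_wrt (>) \<alpha>" "sorted_wrt (>) \<beta>"
    using frobenius_coordinates_strict_decreasing[OF assms(3)] assms(5,6) by simp_all
  have up: "sorted_wrt (>) (?up \<alpha>)" "sorted_wrt (>) (?up \<beta>)"
    using dec by (simp_all add: sorted_wrt_map)
  have parts: "is_partition ?P1" "is_partition ?P2" "is_partition ?P3" "is_partition ?P4"
    using len dec up by (auto intro!: frobenius_partition(1))
  have hooks: "?H ?P1 = ?H ?P4" "?H ?P2 = ?H ?P3"
    using len dec up
    by (auto intro!: hook_product_transposed parts frobenius_partition_transposed)
  have 13: "?d1 * ?H ?P1 = ?d3 * ?H ?P3"
    using simple_gl_module_dim_hook_product[OF parts(1) assms(7)]
      simple_gl_module_dim_hook_product[OF parts(3) assms(9)]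
      content_product_shift[OF len dec, of p m] by simp
  have 24: "?d2 * ?H ?P2 = ?d4 * ?H ?P4"
    using simple_gl_module_dim_hook_product[OF parts(2) assms(8)]
      simple_gl_module_dim_hook_product[OF parts(4) assms(10)]
      content_product_shift[OF len[symmetric] dec(2,1), of q m] by simp
  have "(?d1 * ?d2) * (?H ?P1 * ?H ?P2) = (?d1 * ?H ?P1) * (?d2 * ?H ?P2)"
    by (simp only: mult_ac)
  also have "\<dots> = (?d3 * ?d4) * (?H ?P1 * ?H ?P2)"
    unfolding 13 24 unfolding hooks by (simp only: mult_ac)
  finally have "(?d1 * ?d2) * (?H ?P1 * ?H ?P2) = (?d3 * ?d4) * (?H ?P1 * ?H ?P2)" .
  moreover have "?H ?P1 * ?H ?P2 \<noteq> 0"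
    using hook_product_pos[OF parts(1)] hook_product_pos[OF parts(2)] by simp
  ultimately have "?d1 * ?d2 = ?d3 * ?d4" by simp
  then have "int (vector_space.dim scale1 V1 * vector_space.dim scale2 V2) =
      int (vector_space.dim scale3 V3 * vector_space.dim scale4 V4)"
    by (simp only: of_nat_mult)
  then show ?thesis by (simp only: of_nat_eq_iff)
qed

end
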